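(* Suppose $\gamma>0$, $\alpha>-1$ and $0<p<\infty$. Then for any holomorphic function $f$ on $\mathbb{B}_n$, $f\in\mathcal{A}^p_\alpha$ if and only if $\mathrm{M}_\gamma f\in L^p(\mathbb{B}_n,dv_\alpha)$, where $$(\mathrm{M}_\gamma f)(z)=\sup_{w\in D(z,\gamma)}|f(w)|,\qquad z\in\mathbb{B}_n.$$ Moreover, $$\|f\|_{p,\alpha}\approx\|\mathrm{M}_\gamma f\|_{p,\alpha},$$ where the constants implied by $\approx$ depend only on $\gamma,\alpha,p$ and $n$.
   Context: Fix a positive integer $n$. $\mathbb{B}_n=\{z\in\mathbb{C}^n:|z|<1\}$ is the open unit ball, $\langle z,w\rangle=\sum_k z_k\overline{w_k}$, and $\mathcal{H}(\mathbb{B}_n)$ is the space of holomorphic functions on $\mathbb{B}_n$. $dv$ is Lebesgue measure on $\mathbb{B}_n$ normalized to be a probability measure. For $\alpha>-1$, $dv_\alpha(z)=c_\alpha(1-|z|^2)^\alpha dv(z)$ with $c_\alpha=\Gamma(n+\alpha+1)/[n!\,\Gamma(\alpha+1)]$, which is a probability measure. $\|g\|_{p,\alpha}=\left(\int_{\mathbb{B}_n}|g|^p\,dv_\alpha\right)^{1/p}$, and the weighted Bergman space is $\mathcal{A}^p_\alpha=\mathcal{H}(\mathbb{B}_n)\cap L^p(\mathbb{B}_n,dv_\alpha)$. For $z\in\mathbb{B}_n$, $\varphi_z$ is the standard involutive automorphism of $\mathbb{B}_n$, a biholomorphic self-map with $\varphi_z(0)=z$, $\varphi_z(z)=0$, $\varphi_z\circ\varphi_z=\mathrm{id}$.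 The Bergman metric is $\beta(z,w)=\frac12\log\frac{1+|\varphi_z(w)|}{1-|\varphi_z(w)|}$ and $D(z,\gamma)=\{w\in\mathbb{B}_n:\beta(z,w)<\gamma\}$. For nonnegative (possibly infinite) quantities, $X\approx Y$ means $C^{-1}Y\le X\le CY$ for some constant $C>0$ not depending on $f$. *)

theory Defs
  imports "HOL-Analysis.Analysis"
begin

text \<open>Throughout, complex n-space is the type \<open>complex ^ 'n\<close> with n = \<open>CARD('n)\<close>. Its norm is the
  Euclidean one, so the open unit ball is \<open>ball 0 1\<close>.\<close>

abbreviation unit_ball :: "(complex ^ 'n) set" where
  "unit_ball \<equiv> ball 0 1"

definition herm :: "complex ^ 'n \<Rightarrow> complex ^ 'n \<Rightarrow> complex" where
  "herm z w = (\<Sum>k\<in>UNIV. z $ k * cnj (w $ k))"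

text \<open>Holomorphy in several variables: Frechet differentiable with complex-linear derivative
  (\<open>f'\<close> is already real-linear by the definition of \<open>has_derivative\<close>).\<close>

definition holomorphic_functions :: "(complex ^ 'n) set \<Rightarrow> (complex ^ 'n \<Rightarrow> complex) set" where
  "holomorphic_functions S =
     {f. \<forall>z\<in>S. \<exists>f'. (f has_derivative f') (at z) \<and> (\<forall>c v. f' (c *s v) = c * f' v)}"

text \<open>The space of the following measures is the unit ball itself, so values of functions
  outside of the ball play no role.\<close>

definition ball_measure :: "(complex ^ 'n) measure" where
  "ball_measure = scale_measure (1 / emeasure lebesgue (unit_ball :: (complex ^ 'n) set))
                    (restrict_space lebesgue unit_ball)"

definition weight_const :: "'n itself \<Rightarrow> real \<Rightarrow> real" where
  "weight_const _ \<alpha> = Gamma (real CARD('n) + \<alpha> + 1) / (fact CARD('n) * Gamma (\<alpha> + 1))"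

definition weighted_measure :: "real \<Rightarrow> (complex ^ 'n) measure" where
  "weighted_measure \<alpha> = density ball_measure
     (\<lambda>z. ennreal (weight_const TYPE('n) \<alpha> * (1 - (norm z)\<^sup>2) powr \<alpha>))"

text \<open>Real powers, with exponent \<open>p > 0\<close>, of possibly infinite quantities.\<close>

definition ennpowr :: "ennreal \<Rightarrow> real \<Rightarrow> ennreal" where
  "ennpowr x p = (if x = \<infinity> then \<infinity> else ennreal (enn2real x powr p))"

text \<open>The (quasi-)norm of a nonnegative, possibly infinite function; for a complex function \<open>g\<close>
  apply it to \<open>\<lambda>z. ennreal (norm (g z))\<close>.\<close>

definition Lp_norm :: "real \<Rightarrow> 'a measure \<Rightarrow> ('a \<Rightarrow> ennreal) \<Rightarrow> ennreal" where
  "Lp_norm p M g = ennpowr (\<integral>\<^sup>+ z. ennpowr (g z) p \<partial>M) (1 / p)"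

definition Lp_space :: "real \<Rightarrow> 'a measure \<Rightarrow> ('a \<Rightarrow> complex) set" where
  "Lp_space p M = {g \<in> borel_measurable M. Lp_norm p M (\<lambda>z. ennreal (norm (g z))) < \<infinity>}"

definition Lp_space_enn :: "real \<Rightarrow> 'a measure \<Rightarrow> ('a \<Rightarrow> ennreal) set" where
  "Lp_space_enn p M = {g \<in> borel_measurable M. Lp_norm p M g < \<infinity>}"

definition bergman_space :: "real \<Rightarrow> real \<Rightarrow> (complex ^ 'n \<Rightarrow> complex) set" where
  "bergman_space p \<alpha> = holomorphic_functions unit_ball \<inter> Lp_space p (weighted_measure \<alpha>)"

text \<open>The orthogonal projection onto the complex line spanned by \<open>a\<close>; for \<open>a = 0\<close> it is zero,
  since then \<open>herm z a / herm a a = 0 / 0 = 0\<close>.\<close>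

definition line_proj :: "complex ^ 'n \<Rightarrow> complex ^ 'n \<Rightarrow> complex ^ 'n" where
  "line_proj a z = (herm z a / herm a a) *s a"

text \<open>The standard involutive automorphism of the ball exchanging \<open>0\<close> and \<open>a\<close>, where \<open>norm a < 1\<close>;
  for \<open>a = 0\<close> it is \<open>z \<mapsto> - z\<close>.\<close>

definition ball_aut :: "complex ^ 'n \<Rightarrow> complex ^ 'n \<Rightarrow> complex ^ 'n" where
  "ball_aut a z = (1 / (1 - herm z a)) *s
     (a - line_proj a z - complex_of_real (sqrt (1 - (norm a)\<^sup>2)) *s (z - line_proj a z))"

definition bergman_metric :: "complex ^ 'n \<Rightarrow> complex ^ 'n \<Rightarrow> real" where
  "bergman_metric z w = 1 / 2 * ln ((1 + norm (ball_aut z w)) / (1 - norm (ball_aut z w)))"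

definition bergman_ball :: "complex ^ 'n \<Rightarrow> real \<Rightarrow> (complex ^ 'n) set" where
  "bergman_ball z \<gamma> = {w \<in> unit_ball. bergman_metric z w < \<gamma>}"

definition maximal_fun :: "real \<Rightarrow> (complex ^ 'n \<Rightarrow> complex) \<Rightarrow> complex ^ 'n \<Rightarrow> ennreal" where
  "maximal_fun \<gamma> f z = (SUP w\<in>bergman_ball z \<gamma>. ennreal (norm (f w)))"

lemma herm_self: "herm a a = complex_of_real ((norm a)\<^sup>2)"
  unfolding herm_def norm_vec_def L2_set_def
  by (simp add: sum_nonneg) (simp only: of_real_power[symmetric] complex_norm_square)

lemma ball_aut_0: "ball_aut a 0 = a"
  by (simp add: ball_aut_def line_proj_def herm_def)

lemma ball_aut_0_left: "ball_aut 0 z = - z"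
  by (simp add: ball_aut_def line_proj_def herm_def)

lemma ball_aut_self: "ball_aut a a = 0"
  by (cases "a = 0") (simp_all add: ball_aut_def line_proj_def herm_self vec_eq_iff)

lemma ball_aut_involution:
  fixes a z :: "complex ^ 'n"
  assumes a: "norm a < 1" and z: "herm z a \<noteq> 1"
  shows "ball_aut a (ball_aut a z) = z"
proof (cases "a = 0")
  case True
  then show ?thesis by (simp add: ball_aut_0_left)
next
  case False
  define s t N where "s = complex_of_real (sqrt (1 - (norm a)\<^sup>2))" and "t = herm z a" and "N = herm a a"
  have "norm a ^ 2 < 1" using a by (simp add: power_less_one_iff)
  then have ss: "s * s = 1 - N"
    unfolding s_def N_def herm_self by (simp flip: of_real_mult)
  have N0: "N \<noteq> 0" using False by (simp add: N_def herm_self)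
  have N1: "1 - N \<noteq> 0" using \<open>norm a ^ 2 < 1\<close> unfolding N_def herm_self
    by (metis less_irrefl of_real_1 of_real_eq_iff right_minus_eq)
  have t1: "1 - t \<noteq> 0" using z by (simp add: t_def)
  define c where "c = 1 / (1 - t)"
  define y where "y = ball_aut a z"
  have yk: "y $ k = c * (a $ k - t / N * a $ k - s * (z $ k - t / N * a $ k))" for k
    by (simp add: y_def ball_aut_def line_proj_def s_def t_def N_def c_def diff_divide_distrib right_diff_distrib)
  have "herm y a = (\<Sum>k\<in>UNIV. c * (1 - t / N + s * t / N) * (a $ k * cnj (a $ k)) - c * s * (z $ k * cnj (a $ k)))"
    unfolding herm_def yk by (intro sum.cong) (auto simp: algebra_simps)
  also have "\<dots> = c * (1 - t / N + s * t / N) * N - c * s * t"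
    by (simp add: sum_subtractf flip: sum_distrib_left add: N_def t_def herm_def)
  also have "\<dots> = c * (N - t)" using N0 by (simp add: field_simps)
  finally have hy: "herm y a = c * (N - t)" .
  have d: "1 - herm y a = c * (1 - N)" unfolding hy c_def using t1 by (simp add: field_simps)
  have c0: "c \<noteq> 0" using t1 by (simp add: c_def)
  have "ball_aut a y $ k = z $ k" for k
  proof -
    have ct: "c * t = c - 1" using t1 by (simp add: c_def field_simps)
    have "ball_aut a y $ k = 1 / (1 - herm y a) *
        (a $ k - herm y a / N * a $ k - s * (y $ k - herm y a / N * a $ k))"
      by (simp add: ball_aut_def line_proj_def s_def N_def diff_divide_distrib right_diff_distrib)
    also have "\<dots> = 1 / (c * (1 - N)) *
        (a $ k - c * (N - t) / N * a $ k - s * (y $ k - c * (N - t) / N * a $ k))"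
      unfolding d unfolding hy ..
    also have "y $ k - c * (N - t) / N * a $ k = - s * c * (z $ k - t / N * a $ k)"
      unfolding yk using N0 by (simp add: field_simps)
    also have "a $ k - c * (N - t) / N * a $ k - s * (- s * c * (z $ k - t / N * a $ k))
        = a $ k * (1 - c + c * t / N) + (s * s) * c * (z $ k - t / N * a $ k)"
      using N0 by (simp add: field_simps)
    also have "\<dots> = a $ k * (c * t / N - c * t) + (1 - N) * c * (z $ k - t / N * a $ k)"
      unfolding ss using ct by simp
    also have "\<dots> = c * (1 - N) * z $ k"
      using N0 by (simp add: field_simps)
    finally show ?thesis using c0 N1 by simp
  qed
  then show ?thesis by (simp add: y_def vec_eq_iff)
qed

end

theory Submission
  imports Defs "HOL-Complex_Analysis.Cauchy_Integral_Formula"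
begin

text \<open>Write \<open>d z = 1 - (norm z)\<^sup>2\<close>. Since \<open>z\<close> lies in its own Bergman ball, \<open>\<bar>f\<bar>\<close> is dominated by its
  maximal function, so everything rests on the estimate of \<open>\<integral> (M f)\<^sup>p dv\<^sub>\<alpha>\<close> by a multiple of
  \<open>\<integral> \<bar>f\<bar>\<^sup>p dv\<^sub>\<alpha>\<close>. As usual this comes from a sub-mean value inequality on sets that are comparable to
  Bergman balls, followed by an exchange of integrals.

  The identity \<open>1 - (norm (ball_aut z w))\<^sup>2 = d z * d w / \<bar>1 - \<langle>w, z\<rangle>\<bar>\<^sup>2\<close> (\<open>norm_ball_aut\<close>) turns
  membership in a Bergman ball into the inequality \<open>\<bar>1 - \<langle>w, z\<rangle>\<bar>\<^sup>2 < K d z d w\<close>. The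
  non-strict version, the relation \<open>near K\<close>, is symmetric and satisfies a triangle inequality with
  a loss in the constant (\<open>near_trans\<close>), and \<open>d\<close> is comparable at near points
  (\<open>near_defect_le\<close>). Near a point \<open>w\<close> the relation is squeezed between two multiples of the
  \<open>cell\<close> of vectors \<open>u\<close> with \<open>\<bar>\<langle>u, w\<rangle>\<bar> \<le> d w / 4\<close> and \<open>norm u \<le> sqrt (d w) / 4\<close>: the translate
  \<open>w + cell w\<close> consists of points near \<open>w\<close> (\<open>cell_in_ball\<close>), and all points near \<open>w\<close> lie in
  \<open>w + L cell w\<close> for a constant \<open>L\<close> (\<open>near_in_dilated_cell\<close>). A homothety multiplies volumes by
  a constant, so cells at near points have comparable volumes (\<open>cell_vol_le\<close>).

  A cell is the unit ball of a complex norm, hence invariant under multiplication by complex numbers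
  of modulus one. Averaging the one-variable mean value property over all circles in the cell gives
  \<open>vol(cell w) \<bar>F w\<bar> \<le> \<integral> \<bar>F\<bar>\<close> over \<open>w + cell w\<close> (\<open>mean_value_balanced\<close>). For an arbitrary exponent
  \<open>p > 0\<close> this is applied to \<open>F = f\<^sup>m\<close> with an integer \<open>m \<ge> p\<close>, at a point where \<open>\<bar>f\<bar>\<^sup>p\<close>, weighted by a
  power of the distance to the boundary of the cell, is maximal. Around that point \<open>\<bar>f\<bar>\<close> is at most a
  constant times its value there, which absorbs the surplus power \<open>m - p\<close> (\<open>power_mean_value\<close>).

  If \<open>w\<close> lies in the Bergman ball of \<open>z\<close>, these facts bound \<open>\<bar>f w\<bar>\<^sup>p d(z)\<^sup>\<alpha>\<close> by a constant times the
  integral of \<open>\<bar>f v\<bar>\<^sup>p d(v)\<^sup>\<alpha> / vol(cell v)\<close> over the points \<open>v\<close> near \<open>z\<close>. The bound does not involve \<open>w\<close>, so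
  it holds for \<open>(M f z)\<^sup>p d(z)\<^sup>\<alpha>\<close>; integrating in \<open>z\<close> first, the set of \<open>z\<close> near \<open>v\<close> contributes
  a multiple of \<open>vol(cell v)\<close>, which cancels the denominator (\<open>maximal_integral_le\<close>).\<close>

section \<open>The Hermitian form and the involutions of the ball\<close>

lemma herm_add_left: "herm (u + v) w = herm u w + herm v w"
  and herm_diff_left: "herm (u - v) w = herm u w - herm v w"
  and herm_smult_left: "herm (c *s u) w = c * herm u w"
  by (simp_all add: herm_def sum.distrib sum_subtractf sum_distrib_left algebra_simps)

lemma herm_commute: "herm u w = cnj (herm w u)"
  by (simp add: herm_def cnj_sum mult.commute)

lemma herm_diff_right: "herm w (u - v) = herm w u - herm w v"
  by (metis herm_commute herm_diff_left complex_cnj_diff)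

lemma Re_herm: "Re (herm u w) = u \<bullet> w"
  by (simp add: herm_def inner_vec_def inner_complex_def)

lemma norm_vec_smult: "norm (c *s u) = cmod c * norm (u :: complex ^ 'n)"
  by (simp add: norm_vec_def norm_mult L2_set_right_distrib)

lemma scaleR_eq_smult: "r *\<^sub>R u = complex_of_real r *s (u :: complex ^ 'n)"
  by (simp only: vec_eq_iff vector_scaleR_component vector_smult_component
      scaleR_conv_of_real[where x = "_ :: complex"]) simp

lemma norm_herm_le: "cmod (herm u w) \<le> norm u * norm w"
proof (cases "herm u w = 0")
  case False
  define c where "c = cnj (herm u w) / cmod (herm u w)"
  have "cmod c = 1" using False by (simp add: c_def norm_divide)
  have "c * herm u w = cmod (herm u w)"
    using False by (simp add: c_def complex_norm_square[symmetric] power2_eq_square mult.commute)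
  then have "cmod (herm u w) = (c *s u) \<bullet> w"
    by (metis Re_herm herm_smult_left Re_complex_of_real)
  also have "\<dots> \<le> norm (c *s u) * norm w" by (rule norm_cauchy_schwarz)
  finally show ?thesis by (simp add: norm_vec_smult \<open>cmod c = 1\<close>)
qed simp

lemma norm_sq_add_herm: "(norm (u + v))\<^sup>2 = (norm u)\<^sup>2 + 2 * Re (herm u v) + (norm v)\<^sup>2"
  by (simp add: Re_herm power2_norm_eq_inner inner_add inner_commute)

lemma one_minus_herm_nonzero:
  assumes "norm z < 1" "norm w < 1"
  shows "1 - herm z w \<noteq> 0"
proof -
  have "cmod (herm z w) \<le> norm z * norm w" by (rule norm_herm_le)
  also have "\<dots> < 1" using mult_strict_mono'[OF assms] by simp
  finally show ?thesis by auto
qed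

text \<open>The vectors \<open>x = a - P z\<close> and \<open>y = s (z - P z)\<close> in the numerator of the automorphism, where \<open>P\<close> is the
  projection onto the line through \<open>a\<close> and \<open>s\<close> is the square root in the definition, are orthogonal,
  so the norm of \<open>x - y\<close> follows from Pythagoras.\<close>

lemma norm_ball_aut:
  fixes a z :: "complex ^ 'n"
  assumes a: "norm a < 1" and z: "norm z < 1"
  shows "1 - (norm (ball_aut a z))\<^sup>2
           = (1 - (norm a)\<^sup>2) * (1 - (norm z)\<^sup>2) / (cmod (1 - herm z a))\<^sup>2"
proof -
  define t N s where "t = herm z a" and "N = (norm a)\<^sup>2" and "s = sqrt (1 - N)"
  have "N < 1" using a by (simp add: N_def power_less_one_iff)
  define x y where "x = a - line_proj a z" and "y = complex_of_real s *s (z - line_proj a z)"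
  have t1: "1 - t \<noteq> 0" using one_minus_herm_nonzero[OF z a] by (simp add: t_def)
  have nx: "(norm x)\<^sup>2 + (norm y)\<^sup>2 - 2 * Re (herm x y) = (cmod (1 - t))\<^sup>2 - (1 - N) * (1 - (norm z)\<^sup>2)"
  proof (cases "a = 0")
    case True
    then show ?thesis by (simp add: x_def y_def t_def N_def line_proj_def herm_def s_def)
  next
    case False
    then have N0: "N > 0" by (simp add: N_def)
    have P: "line_proj a z = (t / of_real N) *s a"
      by (simp add: line_proj_def t_def N_def herm_self)
    have x: "x = (1 - t / of_real N) *s a"
      by (simp add: x_def P vec_eq_iff algebra_simps)
    then have "(norm x)\<^sup>2 = (cmod (1 - t / of_real N))\<^sup>2 * N"
      by (simp only: norm_vec_smult power_mult_distrib N_def)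
    also have "\<dots> = ((1 - Re t / N)\<^sup>2 + (Im t / N)\<^sup>2) * N"
      by (simp add: cmod_power2)
    also have "\<dots> = N - 2 * Re t + ((Re t)\<^sup>2 + (Im t)\<^sup>2) / N"
      using N0 by (simp add: field_simps power2_eq_square)
    finally have nx: "(norm x)\<^sup>2 = N - 2 * Re t + ((Re t)\<^sup>2 + (Im t)\<^sup>2) / N" .
    have h: "herm a (z - line_proj a z) = 0"
      using N0 unfolding P herm_diff_right
      by (subst (1 2) herm_commute) (simp add: herm_smult_left herm_self t_def flip: N_def)
    have hxy: "herm x y = 0"
    proof -
      have "herm x y = (1 - t / of_real N) * of_real s * herm a (z - line_proj a z)"
        unfolding x y_def herm_smult_left
        by (subst herm_commute[of a], subst herm_smult_left) (simp add: herm_commute[of _ a])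
      then show ?thesis by (simp add: h)
    qed
    have "(norm z)\<^sup>2 = (norm ((z - line_proj a z) + line_proj a z))\<^sup>2" by simp
    also have "\<dots> = (norm (z - line_proj a z))\<^sup>2 + (norm (line_proj a z))\<^sup>2"
    proof -
      have "herm (z - line_proj a z) (line_proj a z) = 0"
        unfolding P by (subst herm_commute) (simp add: herm_smult_left h[unfolded P])
      then show ?thesis by (subst norm_sq_add_herm) simp
    qed
    also have "(norm (line_proj a z))\<^sup>2 = (cmod t / N)\<^sup>2 * N"
      unfolding P norm_vec_smult using N0 by (simp only: power_mult_distrib norm_divide norm_of_real abs_of_pos) (simp add: N_def)
    also have "\<dots> = ((Re t)\<^sup>2 + (Im t)\<^sup>2) / N"
      using N0 by (simp add: power_divide cmod_power2) (simp add: power2_eq_square)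
    finally have nz: "(norm (z - line_proj a z))\<^sup>2 = (norm z)\<^sup>2 - ((Re t)\<^sup>2 + (Im t)\<^sup>2) / N" by simp
    have "(norm y)\<^sup>2 = s\<^sup>2 * (norm (z - line_proj a z))\<^sup>2"
      unfolding y_def norm_vec_smult by (simp add: power_mult_distrib)
    also have "s\<^sup>2 = 1 - N" using \<open>N < 1\<close> by (simp add: s_def)
    finally have ny: "(norm y)\<^sup>2 = (1 - N) * ((norm z)\<^sup>2 - ((Re t)\<^sup>2 + (Im t)\<^sup>2) / N)"
      by (simp only: nz)
    define Z M where "Z = (norm z)\<^sup>2" and "M = ((Re t)\<^sup>2 + (Im t)\<^sup>2) / N"
    have NM: "N * M = (Re t)\<^sup>2 + (Im t)\<^sup>2" using N0 by (simp add: M_def)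
    have t: "(cmod (1 - t))\<^sup>2 = 1 - 2 * Re t + N * M"
      unfolding cmod_power2 NM by (simp add: power2_eq_square algebra_simps)
    show ?thesis unfolding nx ny hxy t Z_def[symmetric] M_def[symmetric]
      by (simp add: algebra_simps)
  qed
  have "ball_aut a z = (1 / (1 - t)) *s (x - y)"
    by (simp add: ball_aut_def x_def y_def t_def s_def N_def)
  then have "(norm (ball_aut a z))\<^sup>2 = (norm (x - y))\<^sup>2 / (cmod (1 - t))\<^sup>2"
    by (simp only: norm_vec_smult norm_divide power_mult_distrib power_divide) simp
  also have "(norm (x - y))\<^sup>2 = (norm x)\<^sup>2 + (norm y)\<^sup>2 - 2 * Re (herm x y)"
    by (simp add: Re_herm power2_norm_eq_inner inner_diff inner_commute[of y x])
  finally show ?thesis unfolding nx t_def[symmetric] N_def[symmetric] using t1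
    by (simp add: diff_divide_distrib)
qed

definition defect :: "complex ^ 'n \<Rightarrow> real" where
  "defect z = 1 - (norm z)\<^sup>2"

text \<open>For \<open>K > 1\<close> the points of the unit ball that are near \<open>w\<close> form a closed Bergman ball around \<open>w\<close>. The product
  form, without the automorphism, makes it evident that the relation is symmetric and closed.\<close>

definition near :: "real \<Rightarrow> complex ^ 'n \<Rightarrow> complex ^ 'n \<Rightarrow> bool" where
  "near K z w \<longleftrightarrow> (cmod (1 - herm z w))\<^sup>2 \<le> K * (defect z * defect w)"

lemma near_commute: "near K z w \<longleftrightarrow> near K w z"
proof -
  have "1 - herm z w = cnj (1 - herm w z)" by (simp add: herm_commute[of z w])
  then show ?thesis by (simp add: near_def mult.commute del: complex_cnj_diff)
qed

lemma defect_bounds: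
  assumes "norm z < 1"
  shows "0 < defect z" "defect z \<le> 1"
  using assms by (simp_all add: defect_def power_less_one_iff)

text \<open>The Bergman metric is \<open>artanh\<close> of the norm of the automorphism, and \<open>tanh\<close> is increasing, so the
  condition is \<open>norm (ball_aut z w) < tanh \<gamma>\<close>; insert the identity for the norm.\<close>

lemma bergman_ball_iff:
  assumes z: "norm z < 1" and w: "norm w < 1"
  shows "w \<in> bergman_ball z \<gamma> \<longleftrightarrow>
    (0 < \<gamma> \<and> (1 - (tanh \<gamma>)\<^sup>2) * (cmod (1 - herm w z))\<^sup>2 < defect z * defect w)"
proof -
  define x where "x = norm (ball_aut z w)"
  have pos: "(cmod (1 - herm w z))\<^sup>2 > 0" using one_minus_herm_nonzero[OF w z] by simp
  have id: "1 - x\<^sup>2 = defect z * defect w / (cmod (1 - herm w z))\<^sup>2"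
    unfolding x_def defect_def by (rule norm_ball_aut[OF z w])
  moreover have "\<dots> > 0" using pos defect_bounds[OF z] defect_bounds[OF w] by simp
  ultimately have "x\<^sup>2 < 1" by linarith
  moreover have x0: "0 \<le> x" by (simp add: x_def)
  ultimately have x1: "x < 1" by (simp add: power_less_one_iff)
  have "bergman_metric z w = artanh x"
    by (simp add: bergman_metric_def x_def artanh_def)
  then have "w \<in> bergman_ball z \<gamma> \<longleftrightarrow> artanh x < \<gamma>" using w by (simp add: bergman_ball_def)
  also have "\<dots> \<longleftrightarrow> x < tanh \<gamma>"
  proof -
    define y where "y = (1 + x) / (1 - x)"
    have "y > 0" using x0 x1 by (simp add: y_def)
    have "tanh (artanh x) = (1 - 1 / y) / (1 + 1 / y)"
      using \<open>y > 0\<close> by (simp add: artanh_def tanh_real_altdef exp_minus inverse_eq_divide flip: y_def)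
    also have "\<dots> = x" using x0 x1 by (simp add: y_def divide_simps)
    finally have "x = tanh (artanh x)" ..
    then show ?thesis by (metis tanh_real_less_iff)
  qed
  also have "\<dots> \<longleftrightarrow> 0 < \<gamma> \<and> x\<^sup>2 < (tanh \<gamma>)\<^sup>2"
    using x0 by (metis abs_le_square_iff abs_of_nonneg less_le_not_le linorder_not_le order_le_less_trans power2_less_imp_less tanh_real_pos_iff)
  also have "\<dots> \<longleftrightarrow> 0 < \<gamma> \<and> 1 - (tanh \<gamma>)\<^sup>2 < 1 - x\<^sup>2" by auto
  finally show ?thesis unfolding id using pos by (simp add: field_simps)
qed

section \<open>The geometry of Bergman balls\<close>

text \<open>An infinitesimal model of a Bergman ball around \<open>w\<close>, of size \<open>d w\<close> in the direction of \<open>w\<close> and of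
  size \<open>sqrt (d w)\<close> in the orthogonal ones, where \<open>d w\<close> is the defect. The constants make
  \<open>w + cell w\<close> a subset of the unit ball.\<close>

definition cell :: "complex ^ 'n \<Rightarrow> (complex ^ 'n) set" where
  "cell w = {u. cmod (herm u w) \<le> defect w / 4 \<and> (norm u)\<^sup>2 \<le> defect w / 16}"

text \<open>Since \<open>d z / 2 \<le> 1 - norm z \<le> \<bar>1 - \<langle>z, w\<rangle>\<bar>\<close>, the square of \<open>d z\<close> is at most \<open>4 K d z d w\<close>; cancel
  one factor \<open>d z\<close>.\<close>

lemma near_defect_le:
  assumes z: "norm z < 1" and w: "norm w < 1" and "near K z w"
  shows "defect z \<le> 4 * K * defect w"
proof -
  have pos: "defect z > 0" "defect w > 0" using z w by (simp_all add: defect_bounds)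
  have nzw: "norm z * norm w \<le> norm z" using w by (simp add: mult_left_le)
  have "defect z \<le> 2 * (1 - norm z)"
    using zero_le_power2[of "1 - norm z"] by (simp add: defect_def power2_eq_square algebra_simps)
  also have "1 - norm z \<le> 1 - cmod (herm z w)" using norm_herm_le[of z w] nzw by linarith
  also have "1 - cmod (herm z w) \<le> cmod (1 - herm z w)"
    using norm_triangle_ineq2[of 1 "herm z w"] by simp
  finally have "defect z \<le> 2 * cmod (1 - herm z w)" by simp
  then have "(defect z)\<^sup>2 \<le> 4 * (cmod (1 - herm z w))\<^sup>2"
    using pos power_mono[of "defect z" "2 * cmod (1 - herm z w)" 2] by (simp add: power_mult_distrib)
  also have "\<dots> \<le> 4 * (K * (defect z * defect w))" using assms(3) by (simp add: near_def)
  finally have "defect z * defect z \<le> defect z * (4 * K * defect w)"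
    by (simp add: power2_eq_square algebra_simps)
  then show ?thesis using pos by simp
qed

lemma near_norm_one_minus_herm_le:
  assumes z: "norm z < 1" and w: "norm w < 1" and n: "near K z w" and K: "K \<ge> 0"
  shows "cmod (1 - herm z w) \<le> 2 * K * defect w"
proof -
  have pos: "defect z > 0" "defect w > 0" using z w by (simp_all add: defect_bounds)
  have "(cmod (1 - herm z w))\<^sup>2 \<le> K * (defect z * defect w)" using n by (simp add: near_def)
  also have "\<dots> \<le> K * ((4 * K * defect w) * defect w)"
    using near_defect_le[OF z w n] pos K by (intro mult_left_mono mult_right_mono) auto
  also have "\<dots> = (2 * K * defect w)\<^sup>2" by (simp add: power2_eq_square)
  finally show ?thesis using pos K by (auto dest: power2_le_imp_le)
qed

text \<open>Both bounds come from expanding the products: \<open>\<langle>z - w, w\<rangle>\<close> is \<open>d w - (1 - \<langle>z, w\<rangle>)\<close>, and the square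
  of \<open>norm (z - w)\<close> is \<open>2 Re (1 - \<langle>z, w\<rangle>) - d z - d w\<close>.\<close>

lemma near_displacement:
  assumes z: "norm z < 1" and w: "norm w < 1" and n: "near K z w" and K: "K \<ge> 0"
  shows "cmod (herm (z - w) w) \<le> (4 * K + 1) * defect w"
    and "(norm (z - w))\<^sup>2 \<le> (4 * K + 1) * defect w"
proof -
  have pos: "defect z > 0" "defect w > 0" using z w by (simp_all add: defect_bounds)
  have h: "cmod (1 - herm z w) \<le> 2 * K * defect w" by (rule near_norm_one_minus_herm_le[OF assms])
  have Kd: "K * defect w \<ge> 0" using K pos by simp
  have "herm (z - w) w = of_real (defect w) - (1 - herm z w)"
    by (simp add: herm_diff_left herm_self defect_def)
  then have "cmod (herm (z - w) w) \<le> defect w + cmod (1 - herm z w)"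
    using norm_triangle_ineq4[of "of_real (defect w)" "1 - herm z w"] pos by simp
  then show "cmod (herm (z - w) w) \<le> (4 * K + 1) * defect w" using h Kd by (simp add: algebra_simps)
  have "(norm (z - w))\<^sup>2 = 2 * Re (1 - herm z w) - defect z - defect w"
    by (simp add: Re_herm power2_norm_eq_inner inner_diff inner_commute defect_def)
  also have "\<dots> \<le> 2 * cmod (1 - herm z w)" using pos complex_Re_le_cmod[of "1 - herm z w"] by linarith
  finally show "(norm (z - w))\<^sup>2 \<le> (4 * K + 1) * defect w" using h Kd pos by (simp add: algebra_simps)
qed

text \<open>Expand \<open>1 - \<langle>z, v\<rangle>\<close> around \<open>w\<close>: each of the four resulting terms is bounded by a multiple of the
  defect of \<open>w\<close>, which is comparable with those of \<open>z\<close> and \<open>v\<close>.\<close>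

lemma near_trans:
  assumes z: "norm z < 1" and w: "norm w < 1" and v: "norm v < 1"
    and zw: "near K z w" and vw: "near K v w" and K: "K \<ge> 0"
  shows "near ((16 * K * (3 * K + 1))\<^sup>2) z v"
proof -
  define d Q where "d = defect w" and "Q = 4 * K + 1"
  have pos: "defect z > 0" "defect v > 0" "d > 0" using z w v by (simp_all add: defect_bounds d_def)
  note dz = near_displacement[OF z w zw K, folded d_def Q_def]
  note dv = near_displacement[OF v w vw K, folded d_def Q_def]
  have "1 - herm z v = of_real d - herm (z - w) w - cnj (herm (v - w) w) - herm (z - w) (v - w)"
    by (simp add: herm_diff_left herm_diff_right herm_self d_def defect_def herm_commute[of w v])
  then have "cmod (1 - herm z v) \<le> d + cmod (herm (z - w) w) + cmod (cnj (herm (v - w) w)) + cmod (herm (z - w) (v - w))"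
    using pos by (smt (verit) norm_triangle_ineq4 norm_of_real)
  also have "\<dots> \<le> d + Q * d + Q * d + Q * d"
  proof -
    have "cmod (herm (z - w) (v - w)) \<le> norm (z - w) * norm (v - w)" by (rule norm_herm_le)
    also have "\<dots> \<le> ((norm (z - w))\<^sup>2 + (norm (v - w))\<^sup>2) / 2"
      using zero_le_power2[of "norm (z - w) - norm (v - w)"] by (simp add: power2_eq_square algebra_simps)
    also have "\<dots> \<le> Q * d" using dz dv by simp
    finally show ?thesis using dz dv by simp
  qed
  also have "\<dots> = 4 * (3 * K + 1) * d" by (simp add: Q_def algebra_simps)
  finally have "(cmod (1 - herm z v))\<^sup>2 \<le> (4 * (3 * K + 1) * d)\<^sup>2" by (intro power_mono) auto
  also have "\<dots> = (4 * (3 * K + 1))\<^sup>2 * (d * d)" by (simp add: power_mult_distrib power2_eq_square)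
  also have "d * d \<le> (4 * K * defect z) * (4 * K * defect v)"
    using near_defect_le[OF w z, of K] near_defect_le[OF w v, of K] zw vw pos
    by (intro mult_mono) (auto simp: near_commute d_def)
  finally have "(cmod (1 - herm z v))\<^sup>2 \<le> (4 * (3 * K + 1))\<^sup>2 * ((4 * K * defect z) * (4 * K * defect v))"
    by (simp add: mult_left_mono)
  also have "\<dots> = (16 * K * (3 * K + 1))\<^sup>2 * (defect z * defect v)"
    by (simp only: power_mult_distrib power2_eq_square) algebra
  finally show ?thesis unfolding near_def .
qed

text \<open>For \<open>u\<close> in the cell, the defect of \<open>w + u\<close> is at least \<open>7/16\<close> and \<open>\<bar>1 - \<langle>w + u, w\<rangle>\<bar>\<close> at most \<open>5/4\<close> times
  the defect of \<open>w\<close>. The quotient of \<open>(5/4)\<^sup>2\<close> and \<open>7/16\<close> is less than 4.\<close>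

lemma cell_in_ball:
  assumes w: "norm w < 1" and u: "u \<in> cell w"
  shows "norm (w + u) < 1" and "near 4 (w + u) w"
proof -
  define d where "d = defect w"
  have d: "d > 0" using w by (simp add: defect_bounds d_def)
  have hu: "cmod (herm u w) \<le> d / 4" and nu: "(norm u)\<^sup>2 \<le> d / 16"
    using u by (simp_all add: cell_def d_def)
  have "(norm (w + u))\<^sup>2 = 1 - d + 2 * Re (herm u w) + (norm u)\<^sup>2"
    unfolding norm_sq_add_herm by (simp add: d_def defect_def Re_herm inner_commute)
  also have "\<dots> \<le> 1 - 7 / 16 * d" using hu nu complex_Re_le_cmod[of "herm u w"] by linarith
  finally have D: "defect (w + u) \<ge> 7 / 16 * d" by (simp add: defect_def)
  then have "(norm (w + u))\<^sup>2 < 1" using d by (simp add: defect_def)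
  then show "norm (w + u) < 1" by (simp add: power_less_one_iff)
  have "1 - herm (w + u) w = of_real d - herm u w" by (simp add: herm_add_left herm_self d_def defect_def)
  then have "cmod (1 - herm (w + u) w) \<le> d + d / 4"
    using d hu by (smt (verit) norm_triangle_ineq4 norm_of_real)
  then have "(cmod (1 - herm (w + u) w))\<^sup>2 \<le> (5 / 4 * d)\<^sup>2" by (intro power_mono) auto
  also have "\<dots> \<le> 4 * (7 / 16 * d * d)" using d by (simp add: power2_eq_square)
  also have "\<dots> \<le> 4 * (defect (w + u) * d)" using D d by (intro mult_left_mono mult_right_mono) auto
  finally show "near 4 (w + u) w" by (simp add: near_def d_def)
qed

text \<open>By \<open>near_displacement\<close> both \<open>\<bar>\<langle>z - w, w\<rangle>\<bar>\<close> and the square of \<open>norm (z - w)\<close> are at most \<open>4 K + 1\<close>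
  times the defect. The dilation factor is four times this number because of the factor \<open>1/4\<close> in the
  cell.\<close>

lemma near_in_dilated_cell:
  assumes z: "norm z < 1" and w: "norm w < 1" and n: "near K z w" and K: "K \<ge> 0"
  shows "\<exists>u \<in> cell w. z = (16 * K + 4) *\<^sub>R u + w"
proof
  define L where "L = 16 * K + 4"
  have L: "L \<ge> 4" "L > 0" using K by (simp_all add: L_def)
  define u where "u = (1 / L) *\<^sub>R (z - w)"
  show "z = (16 * K + 4) *\<^sub>R u + w" using L by (simp add: u_def flip: L_def)
  have d: "defect w > 0" using w by (simp add: defect_bounds)
  note nd = near_displacement[OF z w n K]
  have "u = complex_of_real (1 / L) *s (z - w)" unfolding u_def by (rule scaleR_eq_smult)
  then have "herm u w = complex_of_real (1 / L) * herm (z - w) w" by (simp only: herm_smult_left)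
  then have "cmod (herm u w) = cmod (herm (z - w) w) / L" using L by (simp add: norm_mult norm_divide)
  also have "\<dots> \<le> ((4 * K + 1) * defect w) / L" using nd L by (intro divide_right_mono) auto
  also have "\<dots> = defect w / 4" using L unfolding L_def by (simp add: field_simps)
  finally have 1: "cmod (herm u w) \<le> defect w / 4" .
  have "(norm u)\<^sup>2 = (norm (z - w))\<^sup>2 / L\<^sup>2" using L by (simp add: u_def power_divide)
  also have "\<dots> \<le> ((4 * K + 1) * defect w) / L\<^sup>2" using nd by (intro divide_right_mono) auto
  also have "(4 * K + 1) * defect w = L * (defect w / 4)" by (simp add: L_def algebra_simps)
  also have "L * (defect w / 4) / L\<^sup>2 = defect w / 4 / L" using L by (simp add: power2_eq_square)
  also have "\<dots> \<le> defect w / 4 / 4" using L d by (intro divide_left_mono) auto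
  finally show "u \<in> cell w" using 1 by (simp add: cell_def)
qed

section \<open>Mean values over balanced sets\<close>

lemma nn_integral_lborel_translate:
  fixes f :: "'a :: euclidean_space \<Rightarrow> ennreal"
  assumes [measurable]: "f \<in> borel_measurable borel"
  shows "(\<integral>\<^sup>+x. f (c + x) \<partial>lborel) = (\<integral>\<^sup>+x. f x \<partial>lborel)"
proof -
  have "(\<integral>\<^sup>+x. f x \<partial>lborel) = (\<integral>\<^sup>+x. f x \<partial>(distr lborel borel ((+) c)))"
    by (simp only: lborel_distr_plus)
  also have "\<dots> = (\<integral>\<^sup>+x. f (c + x) \<partial>lborel)" by (rule nn_integral_distr) auto
  finally show ?thesis ..
qed

text \<open>The uniqueness argument for translation invariant measures: integrate the product of \<open>f (R x)\<close> and
  \<open>b y\<close>, where \<open>b\<close> is the indicator function of the unit ball. Translations in \<open>x\<close> and \<open>y\<close> exchange the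
  roles of the two factors, and \<open>b\<close> is invariant under \<open>R\<close>, so its integral can be cancelled.\<close>

lemma nn_integral_lborel_isometry:
  fixes f :: "'a :: euclidean_space \<Rightarrow> ennreal" and R :: "'a \<Rightarrow> 'a"
  assumes R: "linear R" and norm_R: "\<And>x. norm (R x) = norm x"
    and f[measurable]: "f \<in> borel_measurable borel"
  shows "(\<integral>\<^sup>+x. f (R x) \<partial>lborel) = (\<integral>\<^sup>+x. f x \<partial>lborel)"
proof -
  have [measurable]: "R \<in> borel_measurable borel"
    by (intro borel_measurable_continuous_onI linear_continuous_on linear_linear[THEN iffD2] R)
  have "inj R" using R norm_R by (metis linear_injective_0 norm_eq_zero)
  then have "surj R" using linear_injective_imp_surjective[OF R] by simp
  then obtain S where S: "\<And>y. R (S y) = y" by (metis surj_f_inv_f)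
  define b where "b = (indicator (ball 0 1) :: 'a \<Rightarrow> ennreal)"
  have [measurable]: "b \<in> borel_measurable borel"
    unfolding b_def by (intro borel_measurable_indicator) simp
  have bR: "b (- R x) = b x" for x by (simp add: b_def indicator_def norm_R)
  have b: "(\<integral>\<^sup>+x. b x \<partial>lborel) = emeasure lborel (ball (0::'a) 1)" by (simp add: b_def)
  have b_pos: "(\<integral>\<^sup>+x. b x \<partial>lborel) \<noteq> 0" "(\<integral>\<^sup>+x. b x \<partial>lborel) \<noteq> top"
    unfolding b using emeasure_lborel_ball_finite[of "0::'a" 1] content_ball_pos[of 1 "0::'a"]
    by (auto simp: less_top measure_def)
  have "(\<integral>\<^sup>+x. f (R x) \<partial>lborel) * (\<integral>\<^sup>+y. b y \<partial>lborel)
      = (\<integral>\<^sup>+x. \<integral>\<^sup>+y. f (R x) * b y \<partial>lborel \<partial>lborel)"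
    by (simp add: nn_integral_cmult nn_integral_multc)
  also have "\<dots> = (\<integral>\<^sup>+x. \<integral>\<^sup>+y. f (R x) * b (- R x + y) \<partial>lborel \<partial>lborel)"
    by (intro nn_integral_cong nn_integral_lborel_translate[symmetric]) simp
  also have "\<dots> = (\<integral>\<^sup>+y. \<integral>\<^sup>+x. f (R x) * b (- R x + y) \<partial>lborel \<partial>lborel)"
    by (intro lborel_pair.Fubini'[symmetric]) measurable
  also have "\<dots> = (\<integral>\<^sup>+y. \<integral>\<^sup>+x. f (R (S y + x)) * b (- R (S y + x) + y) \<partial>lborel \<partial>lborel)"
    by (intro nn_integral_cong nn_integral_lborel_translate[symmetric]) measurable
  also have "\<dots> = (\<integral>\<^sup>+y. \<integral>\<^sup>+x. f (R x + y) * b x \<partial>lborel \<partial>lborel)"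
    by (simp add: linear_add[OF R] S bR add.commute)
  also have "\<dots> = (\<integral>\<^sup>+x. \<integral>\<^sup>+y. f (R x + y) * b x \<partial>lborel \<partial>lborel)"
    by (intro lborel_pair.Fubini') measurable
  also have "\<dots> = (\<integral>\<^sup>+x. \<integral>\<^sup>+y. f y * b x \<partial>lborel \<partial>lborel)"
    by (intro nn_integral_cong nn_integral_lborel_translate) simp
  also have "\<dots> = (\<integral>\<^sup>+x. f x \<partial>lborel) * (\<integral>\<^sup>+y. b y \<partial>lborel)"
    by (simp add: nn_integral_cmult nn_integral_multc)
  finally show ?thesis using b_pos
    by (simp add: mult.commute[of _ "\<integral>\<^sup>+x. b x \<partial>lborel"] ennreal_mult_cancel_left)
qed

text \<open>Cauchy's integral formula at the centre of the unit circle.\<close>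

lemma circle_mean_value_le:
  fixes f :: "complex \<Rightarrow> complex"
  assumes f: "f holomorphic_on cball 0 1"
  shows "ennreal (2 * pi * cmod (f 0))
    \<le> (\<integral>\<^sup>+t. ennreal (cmod (f (cis t))) * indicator {0..2*pi} t \<partial>lborel)"
proof -
  have "((\<lambda>u. f u / (u - 0)) has_contour_integral (2 * of_real pi * \<i> * f 0)) (part_circlepath 0 1 0 (2*pi))"
    using Cauchy_integral_circlepath_simple[OF f, of 0] by (simp add: circlepath_def)
  then have int: "((\<lambda>t. \<i> * f (cis t)) has_integral (2 * of_real pi * \<i> * f 0)) {0..2*pi}"
    by (subst (asm) has_contour_integral_part_circlepath_iff) (simp_all add: mult_ac)
  have cont: "continuous_on {0..2*pi} (\<lambda>t. f (cis t))"
    by (intro continuous_on_compose2[OF holomorphic_on_imp_continuous_on[OF f]])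
       (auto intro!: continuous_intros)
  define I where "I = integral {0..2*pi} (\<lambda>t. cmod (f (cis t)))"
  have intn: "((\<lambda>t. cmod (f (cis t))) has_integral I) {0..2*pi}"
    unfolding I_def by (intro integrable_integral integrable_continuous_real continuous_intros cont)
  have "2 * pi * cmod (f 0) = cmod (2 * of_real pi * \<i> * f 0)" by (simp add: norm_mult)
  also have "\<dots> \<le> I"
    unfolding I_def integral_unique[OF int, symmetric]
    by (intro integral_norm_bound_integral has_integral_integrable[OF int] has_integral_integrable[OF intn])
       (simp add: norm_mult)
  finally have "2 * pi * cmod (f 0) \<le> I" .
  moreover have "ennreal I = (\<integral>\<^sup>+t. ennreal (cmod (f (cis t))) * indicator {0..2*pi} t \<partial>lborel)"
    by (subst nn_integral_has_integral_lebesgue[OF _ intn, symmetric])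
       (auto simp: nn_integral_completion indicator_def intro!: nn_integral_cong)
  ultimately show ?thesis by (metis ennreal_leI)
qed

lemma holomorphic_functions_continuous_on:
  "f \<in> holomorphic_functions S \<Longrightarrow> continuous_on S f"
  unfolding holomorphic_functions_def
  unfolding continuous_on_eq_continuous_within
  by (blast intro: continuous_at_imp_continuous_at_within has_derivative_continuous)

lemma holomorphic_functions_power:
  assumes "f \<in> holomorphic_functions S"
  shows "(\<lambda>z. f z ^ m) \<in> holomorphic_functions S"
  unfolding holomorphic_functions_def
proof (intro CollectI ballI)
  fix z assume "z \<in> S"
  then obtain f' where f': "(f has_derivative f') (at z)" "\<And>c v. f' (c *s v) = c * f' v"
    using assms unfolding holomorphic_functions_def by blast
  have "((\<lambda>z. f z ^ m) has_derivative (\<lambda>y. of_nat m * f' y * f z ^ (m - 1))) (at z)"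
    by (rule has_derivative_power[OF f'(1)])
  then show "\<exists>g. ((\<lambda>z. f z ^ m) has_derivative g) (at z) \<and> (\<forall>c v. g (c *s v) = c * g v)"
    by (intro exI conjI) (auto simp: f'(2))
qed

lemma holomorphic_functions_slice:
  assumes f: "f \<in> holomorphic_functions S" and T: "\<And>l. l \<in> T \<Longrightarrow> x + l *s u \<in> S"
  shows "(\<lambda>l. f (x + l *s u)) holomorphic_on T"
proof (rule holomorphic_onI)
  fix l assume "l \<in> T"
  then obtain f' where f': "(f has_derivative f') (at (x + l *s u))" "\<And>c v. f' (c *s v) = c * f' v"
    using f T unfolding holomorphic_functions_def by blast
  have "linear (\<lambda>l. l *s u)"
    by (rule linearI) (simp_all add: vec_eq_iff algebra_simps)
  then have "((\<lambda>l. x + l *s u) has_derivative (\<lambda>l. l *s u)) (at l)"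
    by (auto intro!: derivative_eq_intros linear_imp_has_derivative)
  from has_derivative_compose[OF this f'(1)]
  have "((\<lambda>l. f (x + l *s u)) has_derivative (\<lambda>c. f' u * c)) (at l)"
    by (simp add: f'(2) mult.commute)
  then show "(\<lambda>l. f (x + l *s u)) field_differentiable (at l within T)"
    unfolding field_differentiable_def has_field_derivative_def
    using has_derivative_at_withinI by blast
qed

lemma continuous_on_vec_smult [continuous_intros]:
  fixes u :: "'a :: topological_space \<Rightarrow> complex ^ 'n"
  shows "continuous_on A c \<Longrightarrow> continuous_on A u \<Longrightarrow> continuous_on A (\<lambda>x. c x *s u x)"
  unfolding vector_scalar_mult_def by (intro continuous_intros)

lemma measurable_norm_on_open:
  assumes "open S" "continuous_on S g"
  shows "(\<lambda>v. ennreal (norm (g v)) * indicator S v) \<in> borel_measurable borel"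
proof -
  have [measurable]: "(\<lambda>v. indicator S v *\<^sub>R g v) \<in> borel_measurable borel"
    using assms by (intro borel_measurable_continuous_on_indicator) auto
  have "(\<lambda>v. ennreal (norm (indicator S v *\<^sub>R g v))) \<in> borel_measurable borel"
    by measurable
  also have "(\<lambda>v. ennreal (norm (indicator S v *\<^sub>R g v))) = (\<lambda>v. ennreal (norm (g v)) * indicator S v)"
    by (auto simp: indicator_def)
  finally show ?thesis .
qed

text \<open>For each \<open>u \<in> B\<close> the mean value inequality holds on the circle of the points \<open>x + cis t *s u\<close>.
  Integrating over \<open>u \<in> B\<close> and exchanging the integrals, the rotation by \<open>cis t\<close> disappears because it
  preserves both \<open>B\<close> and the measure.\<close>

lemma mean_value_balanced:
  fixes F :: "complex ^ 'n \<Rightarrow> complex"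
  assumes S: "open S" and F: "F \<in> holomorphic_functions S"
    and B[measurable]: "B \<in> sets borel" and bal: "\<And>u c. u \<in> B \<Longrightarrow> cmod c \<le> 1 \<Longrightarrow> c *s u \<in> B"
    and BS: "\<And>u. u \<in> B \<Longrightarrow> x + u \<in> S"
  shows "ennreal (cmod (F x)) * emeasure lborel B
           \<le> (\<integral>\<^sup>+u. ennreal (cmod (F (x + u))) * indicator B u \<partial>lborel)"
proof -
  define H where "H = (\<lambda>v. ennreal (cmod (F v)) * indicator S v)"
  have [measurable]: "H \<in> borel_measurable borel" unfolding H_def
    by (intro measurable_norm_on_open S holomorphic_functions_continuous_on F)
  define J where "J = (\<integral>\<^sup>+u. H (x + u) * indicator B u \<partial>lborel)"
  have "(\<lambda>p. x + cis (snd p) *s fst p) \<in> borel_measurable (borel :: ((complex ^ 'n) \<times> real) measure)"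
    by (intro borel_measurable_continuous_onI continuous_intros)
  then have [measurable]: "(\<lambda>p. x + cis (snd p) *s fst p) \<in> borel_measurable (borel \<Otimes>\<^sub>M borel)"
    by (simp add: borel_prod)
  have circ: "ennreal (2 * pi * cmod (F x)) * indicator B u
      \<le> (\<integral>\<^sup>+t. H (x + cis t *s u) * indicator B u * indicator {0..2*pi} t \<partial>lborel)" for u
  proof (cases "u \<in> B")
    case True
    have hol: "(\<lambda>l. F (x + l *s u)) holomorphic_on cball 0 1"
      by (intro holomorphic_functions_slice[OF F] BS bal True) auto
    have "H (x + cis t *s u) = ennreal (cmod (F (x + cis t *s u)))" for t
      using BS[OF bal[OF True, of "cis t"]] by (simp add: H_def)
    then show ?thesis using circle_mean_value_le[OF hol] True by simp
  qed simp
  have "ennreal (2 * pi) * (ennreal (cmod (F x)) * emeasure lborel B)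
      = (\<integral>\<^sup>+u. ennreal (2 * pi * cmod (F x)) * indicator B u \<partial>lborel)"
    by (subst nn_integral_cmult_indicator) (auto simp: ennreal_mult mult.assoc)
  also have "\<dots> \<le> (\<integral>\<^sup>+u. \<integral>\<^sup>+t. H (x + cis t *s u) * indicator B u * indicator {0..2*pi} t \<partial>lborel \<partial>lborel)"
    by (intro nn_integral_mono circ)
  also have "\<dots> = (\<integral>\<^sup>+t. \<integral>\<^sup>+u. H (x + cis t *s u) * indicator B u * indicator {0..2*pi} t \<partial>lborel \<partial>lborel)"
    by (intro lborel_pair.Fubini'[symmetric]) measurable
  also have "\<dots> = (\<integral>\<^sup>+t. J * indicator {0..2*pi} t \<partial>lborel)"
  proof (intro nn_integral_cong)
    fix t :: real
    have lin: "linear (\<lambda>u :: complex ^ 'n. cis t *s u)"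
      by (rule linearI) (simp_all add: vec_eq_iff algebra_simps)
    have B_iff: "cis t *s u \<in> B \<longleftrightarrow> u \<in> B" for u
      using bal[of u "cis t"] bal[of "cis t *s u" "cis (- t)"]
      by (auto simp: vector_smult_assoc cis_mult)
    have "(\<lambda>u. cis t *s u) \<in> borel_measurable (borel :: (complex ^ 'n) measure)"
      by (intro borel_measurable_continuous_onI continuous_intros)
    note [measurable] = this
    have "(\<integral>\<^sup>+u. H (x + cis t *s u) * indicator B u * indicator {0..2*pi} t \<partial>lborel)
        = (\<integral>\<^sup>+u. H (x + cis t *s u) * indicator B (cis t *s u) \<partial>lborel) * indicator {0..2*pi} t"
      by (subst nn_integral_multc) (auto simp: indicator_def B_iff cong: if_cong)
    also have "(\<integral>\<^sup>+u. H (x + cis t *s u) * indicator B (cis t *s u) \<partial>lborel) = J"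
      unfolding J_def by (rule nn_integral_lborel_isometry[OF lin]) (auto simp: norm_vec_smult)
    finally show "(\<integral>\<^sup>+u. H (x + cis t *s u) * indicator B u * indicator {0..2*pi} t \<partial>lborel)
        = J * indicator {0..2*pi} t" .
  qed
  also have "\<dots> = ennreal (2 * pi) * J"
    by (simp add: nn_integral_cmult_indicator mult.commute)
  finally have "ennreal (cmod (F x)) * emeasure lborel B \<le> J"
    by (subst (asm) ennreal_mult_le_mult_iff) auto
  also have "J = (\<integral>\<^sup>+u. ennreal (cmod (F (x + u))) * indicator B u \<partial>lborel)"
    unfolding J_def H_def by (intro nn_integral_cong) (auto simp: indicator_def BS)
  finally show ?thesis .
qed

section \<open>Mean values of powers of a holomorphic function\<close>

text \<open>The function \<open>q\<close> is a complex norm with unit ball \<open>B\<close>. Exponents \<open>p < 1\<close> are out of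
  reach of Jensen's inequality; the argument, due to Hardy and Littlewood, treats all \<open>p\<close> alike.
  Choose \<open>u0\<close> in \<open>B\<close> where \<open>\<bar>f (x + u)\<bar>\<^sup>p (1 - q u)\<^sup>N\<close> is maximal, \<open>N\<close> being the real dimension, and let
  \<open>A = \<bar>f (x + u0)\<bar>\<close> and \<open>r = (1 - q u0) / 2\<close>. On the ball of radius \<open>r\<close> around \<open>u0\<close> the weight is at least
  \<open>r\<^sup>N\<close>, so maximality gives \<open>\<bar>f\<bar> \<le> 2\<^bsup>N/p\<^esup> A\<close> there. The mean value inequality for \<open>f\<^sup>m\<close> on that
  small ball then yields \<open>A\<^sup>m r\<^sup>N vol B \<le> (2\<^bsup>N/p\<^esup> A)\<^bsup>m-p\<^esup> \<integral> \<bar>f\<bar>\<^sup>p\<close>. After division by \<open>A\<^bsup>m-p\<^esup>\<close>, the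
  claim follows from \<open>\<bar>f x\<bar>\<^sup>p \<le> A\<^sup>p (2 r)\<^sup>N\<close>, which is maximality compared with \<open>u = 0\<close>.\<close>

lemma power_mean_value:
  fixes f :: "complex ^ 'n \<Rightarrow> complex" and q :: "complex ^ 'n \<Rightarrow> real"
  assumes q_cont: "continuous_on UNIV q" and q_add: "\<And>u v. q (u + v) \<le> q u + q v"
    and q_smult: "\<And>c u. q (c *s u) = cmod c * q u" and q_bounded: "bounded {u. q u \<le> 1}"
    and S: "open S" and f: "f \<in> holomorphic_functions S" and qS: "\<And>u. q u \<le> 1 \<Longrightarrow> x + u \<in> S"
    and p: "0 < p" "p \<le> real m"
  shows "ennreal (cmod (f x) powr p) * emeasure lborel {u. q u \<le> 1}
    \<le> ennreal (2 powr (real DIM(complex ^ 'n) * real m / p))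
      * (\<integral>\<^sup>+u. ennreal (cmod (f (x + u)) powr p) * indicator {u. q u \<le> 1} u \<partial>lborel)"
proof -
  define N where "N = real DIM(complex ^ 'n)"
  define B where "B = {u. q u \<le> 1}"
  define g where "g u = cmod (f (x + u))" for u
  define J where "J = (\<integral>\<^sup>+u. ennreal (g u powr p) * indicator B u \<partial>lborel)"
  have q0: "q 0 = 0" using q_smult[of 0 0] by simp
  have q_minus: "q (- u) = q u" for u using q_smult[of "- 1" u] by simp
  have q_nonneg: "0 \<le> q u" for u using q_add[of u "- u"] q_minus[of u] q0 by simp
  have q_scale: "q (r *\<^sub>R u) = r * q u" if "r \<ge> 0" for r u
  proof -
    show ?thesis using that by (simp add: scaleR_eq_smult q_smult)
  qed
  have closed_q: "closed {u. q u \<le> r}" for r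
    by (intro closed_Collect_le q_cont continuous_intros)
  then have [measurable]: "{u. q u \<le> r} \<in> sets borel" for r by simp
  have [measurable]: "B \<in> sets borel" by (simp add: B_def)
  have "compact B" unfolding B_def using q_bounded closed_q compact_eq_bounded_closed by blast
  moreover have "0 \<in> B" by (simp add: B_def q0)
  moreover have g_cont: "continuous_on B g" unfolding g_def
    by (intro continuous_intros continuous_on_compose2[OF holomorphic_functions_continuous_on[OF f]])
       (auto simp: B_def qS)
  then have "continuous_on B (\<lambda>u. g u powr p * (1 - q u) powr N)"
    using p by (intro continuous_intros continuous_on_powr' continuous_on_subset[OF q_cont])
       (auto simp: g_def B_def N_def)
  ultimately obtain u0 where u0: "u0 \<in> B"
    and max: "\<And>u. u \<in> B \<Longrightarrow> g u powr p * (1 - q u) powr N \<le> g u0 powr p * (1 - q u0) powr N"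
    using continuous_attains_sup[of B "\<lambda>u. g u powr p * (1 - q u) powr N"] by blast
  define A r where "A = g u0" and "r = (1 - q u0) / 2"
  have r2: "1 - q u0 = 2 * r" by (simp add: r_def)
  then have q_u0: "q u0 = 1 - 2 * r" by simp
  have at_0: "g 0 powr p \<le> A powr p * (2 * r) powr N"
    using max[OF \<open>0 \<in> B\<close>] by (simp add: q0 A_def r2)
  have N: "N > 0" by (simp add: N_def)
  have A0: "A \<ge> 0" by (simp add: A_def g_def)
  have r0: "r \<ge> 0" using u0 by (simp add: r_def B_def)
  show ?thesis
  proof (cases "A = 0 \<or> r = 0")
    case True
    then have "g 0 powr p = 0" using at_0 p N by (auto simp: order_antisym)
    then show ?thesis by (simp add: g_def)
  next
    case False
    with A0 r0 have A: "A > 0" and r: "r > 0" by auto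
    define B' where "B' = {u. q u \<le> r}"
    have [measurable]: "B' \<in> sets borel" by (simp add: B'_def)
    have sub: "u0 + u \<in> B" and near_u0: "g (u0 + u) \<le> 2 powr (N / p) * A" if "u \<in> B'" for u
    proof -
      have q1: "q (u0 + u) \<le> 1 - r" using q_add[of u0 u] that by (simp add: B'_def q_u0)
      then show "u0 + u \<in> B" using r by (simp add: B_def)
      have "g (u0 + u) powr p * r powr N \<le> g (u0 + u) powr p * (1 - q (u0 + u)) powr N"
        using q1 r N by (intro mult_left_mono powr_mono2) auto
      also have "\<dots> \<le> A powr p * (2 * r) powr N"
        using max[OF \<open>u0 + u \<in> B\<close>] by (simp add: A_def r2)
      also have "\<dots> = (2 powr N * A powr p) * r powr N" using r by (simp add: powr_mult)
      finally have "g (u0 + u) powr p \<le> 2 powr N * A powr p" using r by simp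
      also have "\<dots> = (2 powr (N / p) * A) powr p" using A p by (simp add: powr_mult powr_powr)
      finally show "g (u0 + u) \<le> 2 powr (N / p) * A"
        using p A powr_less_mono2[of p "2 powr (N / p) * A" "g (u0 + u)"] by fastforce
    qed
    define K where "K = 2 powr (N / p) * A"
    have scaled: "B' = (\<lambda>u. r *\<^sub>R u + 0) ` B"
    proof safe
      fix u assume "u \<in> B'"
      then have "(1 / r) *\<^sub>R u \<in> B" using r by (simp add: B_def B'_def q_scale field_simps)
      moreover have "u = r *\<^sub>R ((1 / r) *\<^sub>R u) + 0" using r by simp
      ultimately show "u \<in> (\<lambda>u. r *\<^sub>R u + 0) ` B" by blast
    next
      fix u assume "u \<in> B" then show "r *\<^sub>R u + 0 \<in> B'"
        using r by (simp add: B_def B'_def q_scale mult_left_le)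
    qed
    have "emeasure lborel B' = emeasure lebesgue B'" by simp
    also have "\<dots> = \<bar>r\<bar> ^ DIM(complex ^ 'n) * emeasure lebesgue B"
      unfolding scaled by (rule emeasure_lebesgue_affine)
    also have "\<dots> = ennreal (r powr N) * emeasure lborel B"
      unfolding N_def powr_realpow[OF r] using r by (simp add: ennreal_power)
    finally have vol: "emeasure lborel B' = ennreal (r powr N) * emeasure lborel B" .
    have "ennreal (A ^ m) * emeasure lborel B'
        \<le> (\<integral>\<^sup>+u. ennreal (cmod (f ((x + u0) + u) ^ m)) * indicator B' u \<partial>lborel)"
      unfolding A_def g_def norm_power[symmetric]
      by (rule mean_value_balanced[OF S holomorphic_functions_power[OF f]])
         (use sub qS r in \<open>auto simp: B'_def B_def q_smult add.assoc intro: order_trans[OF mult_left_le_one_le] q_nonneg\<close>)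
    also have "\<dots> \<le> (\<integral>\<^sup>+u. ennreal (K powr (m - p)) * (ennreal (g (u0 + u) powr p) * indicator B (u0 + u)) \<partial>lborel)"
    proof (intro nn_integral_mono)
      fix u
      have "g (u0 + u) ^ m \<le> K powr (m - p) * g (u0 + u) powr p" if "u \<in> B'"
      proof (cases "g (u0 + u) = 0")
        case True
        moreover have "m > 0" using p by (cases m) auto
        ultimately show ?thesis by (simp add: zero_power)
      next
        case False
        then have g: "g (u0 + u) > 0" by (simp add: g_def)
        have "g (u0 + u) ^ m = g (u0 + u) powr (m - p) * g (u0 + u) powr p"
          using g by (simp add: powr_realpow flip: powr_add)
        also have "\<dots> \<le> K powr (m - p) * g (u0 + u) powr p"
          using near_u0[OF that] g p by (intro mult_right_mono powr_mono2) (auto simp: K_def)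
        finally show ?thesis .
      qed
      then show "ennreal (cmod (f ((x + u0) + u) ^ m)) * indicator B' u
          \<le> ennreal (K powr (m - p)) * (ennreal (g (u0 + u) powr p) * indicator B (u0 + u))"
        using sub[of u] by (auto simp: indicator_def g_def norm_power add.assoc simp flip: ennreal_mult intro!: ennreal_leI)
    qed
    also have "\<dots> = ennreal (K powr (m - p)) * J"
    proof -
      have [measurable]: "(\<lambda>u. ennreal (g u powr p) * indicator B u) \<in> borel_measurable borel"
      proof -
        have [measurable]: "(\<lambda>u. indicator B u *\<^sub>R g u) \<in> borel_measurable borel"
          by (intro borel_measurable_continuous_on_indicator g_cont) simp
        have "(\<lambda>u. ennreal ((indicator B u *\<^sub>R g u) powr p)) \<in> borel_measurable borel" by measurable
        also have "(\<lambda>u. ennreal ((indicator B u *\<^sub>R g u) powr p)) = (\<lambda>u. ennreal (g u powr p) * indicator B u)"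
          using p by (auto simp: indicator_def)
        finally show ?thesis .
      qed
      then show ?thesis unfolding J_def
        by (subst nn_integral_cmult) (auto simp: nn_integral_lborel_translate[of "\<lambda>u. ennreal (g u powr p) * indicator B u" u0])
    qed
    finally have "ennreal (A ^ m) * (ennreal (r powr N) * emeasure lborel B) \<le> ennreal (K powr (m - p)) * J"
      by (simp add: vol)
    then have "ennreal (2 powr N * A powr (p - m)) * (ennreal (A ^ m) * (ennreal (r powr N) * emeasure lborel B))
        \<le> ennreal (2 powr N * A powr (p - m)) * (ennreal (K powr (m - p)) * J)"
      by (rule mult_left_mono) simp
    also have "\<dots> = ennreal (2 powr (N * m / p)) * J"
    proof -
      have "2 powr N * A powr (p - m) * K powr (m - p) = 2 powr (N + N / p * (m - p)) * (A powr (p - m) * A powr (m - p))"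
        using A by (simp add: K_def powr_mult powr_powr powr_add)
      also have "N + N / p * (m - p) = N * m / p" using p by (simp add: field_simps)
      also have "A powr (p - m) * A powr (m - p) = 1" using A by (simp flip: powr_add)
      finally show ?thesis by (simp flip: mult.assoc ennreal_mult)
    qed
    also have "ennreal (2 powr N * A powr (p - m)) * (ennreal (A ^ m) * (ennreal (r powr N) * emeasure lborel B))
        = ennreal (A powr p * (2 * r) powr N) * emeasure lborel B"
    proof -
      have "A powr (p - m) * A ^ m = A powr p"
        using A by (simp add: powr_realpow[symmetric] flip: powr_add)
      then have "2 powr N * A powr (p - m) * (A ^ m * r powr N) = A powr p * (2 * r) powr N"
        using r by (simp add: powr_mult)
      then show ?thesis using A by (simp flip: mult.assoc ennreal_mult)
    qed
    finally have "ennreal (A powr p * (2 * r) powr N) * emeasure lborel B \<le> ennreal (2 powr (N * m / p)) * J" .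
    moreover have "ennreal (g 0 powr p) * emeasure lborel B \<le> ennreal (A powr p * (2 * r) powr N) * emeasure lborel B"
      using at_0 by (intro mult_right_mono ennreal_leI) auto
    ultimately show ?thesis by (simp add: J_def g_def B_def N_def)
  qed
qed

section \<open>Measurability and volumes of cells\<close>

lemma near_mono:
  assumes "near K z w" "K \<le> K'" "norm z < 1" "norm w < 1"
  shows "near K' z w"
proof -
  have "0 \<le> defect z * defect w" using assms defect_bounds(1)[of z] defect_bounds(1)[of w] by simp
  then have "K * (defect z * defect w) \<le> K' * (defect z * defect w)"
    using assms by (intro mult_right_mono)
  then show ?thesis using assms(1) by (simp add: near_def)
qed

lemma continuous_on_herm [continuous_intros]:
  "continuous_on A u \<Longrightarrow> continuous_on A w \<Longrightarrow> continuous_on A (\<lambda>x. herm (u x) (w x))"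
  unfolding herm_def by (intro continuous_intros)

lemma continuous_on_defect [continuous_intros]:
  "continuous_on A u \<Longrightarrow> continuous_on A (\<lambda>x. defect (u x))"
  unfolding defect_def by (intro continuous_intros)

lemma closed_near: "closed {p. near K (fst p) (snd p)}"
  unfolding near_def by (intro closed_Collect_le continuous_intros)

lemma pred_near [measurable]:
  assumes [measurable]: "f \<in> borel_measurable M" "g \<in> borel_measurable M"
  shows "Measurable.pred M (\<lambda>x. near K (f x) (g x))"
proof -
  have "{p. near K (fst p) (snd p)} \<in> sets borel" by (intro borel_closed closed_near)
  then have "Measurable.pred (borel \<Otimes>\<^sub>M borel) (\<lambda>p :: (complex ^ 'n) \<times> (complex ^ 'n). near K (fst p) (snd p))"
    by (simp add: pred_def borel_prod)
  from measurable_compose[OF _ this, of "\<lambda>x. (f x, g x)"] show ?thesis by simp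
qed

lemma closed_cell_graph: "closed {p. snd p \<in> cell (fst p)}"
  unfolding cell_def mem_Collect_eq
  by (intro closed_Collect_conj closed_Collect_le continuous_intros) simp_all

lemma closed_cell: "closed (cell w)"
  unfolding cell_def by (intro closed_Collect_conj closed_Collect_le continuous_intros) simp_all

lemma sets_cell [measurable]: "cell w \<in> sets borel"
  by (intro borel_closed closed_cell)

lemma cell_subset: "cell w \<subseteq> cball 0 1"
proof
  fix u assume "u \<in> cell w"
  then have "(norm u)\<^sup>2 \<le> 1\<^sup>2" by (simp add: cell_def defect_def)
      (smt (verit) zero_le_power2)
  then show "u \<in> cball 0 1" using power2_le_imp_le[of "norm u" 1] by simp
qed

lemma compact_cell: "compact (cell w)"
  by (simp add: compact_eq_bounded_closed closed_cell bounded_subset[OF bounded_cball cell_subset])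

lemma cball_subset_cell:
  assumes w: "norm w < 1" shows "cball 0 (defect w / 4) \<subseteq> cell w"
proof
  fix u :: "complex ^ 'a" assume "u \<in> cball 0 (defect w / 4)"
  then have u: "norm u \<le> defect w / 4" by simp
  have d: "0 < defect w" "defect w \<le> 1" using w by (simp_all add: defect_bounds)
  have "cmod (herm u w) \<le> norm u * norm w" by (rule norm_herm_le)
  also have "\<dots> \<le> norm u" using w by (simp add: mult_left_le)
  finally have "cmod (herm u w) \<le> defect w / 4" using u by simp
  moreover have "(norm u)\<^sup>2 \<le> (defect w / 4)\<^sup>2" using u by (intro power_mono) auto
  moreover have "(defect w / 4)\<^sup>2 \<le> defect w / 16"
    using d by (simp add: power2_eq_square mult_left_le)
  ultimately show "u \<in> cell w" by (simp add: cell_def)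
qed

definition cell_vol :: "complex ^ 'n \<Rightarrow> real" where
  "cell_vol w = measure lborel (cell w)"

lemma emeasure_cell: "emeasure lborel (cell w) = ennreal (cell_vol w)"
  unfolding cell_vol_def
  using emeasure_compact_finite[OF compact_cell[of w]] by (intro emeasure_eq_ennreal_measure) auto

lemma cell_vol_pos:
  assumes "norm w < 1" shows "cell_vol w > 0"
proof -
  have "0 < measure lborel (cball (0 :: complex ^ 'a) (defect w / 4))"
    using assms by (intro content_cball_pos) (simp add: defect_bounds)
  also have "\<dots> \<le> cell_vol w" unfolding cell_vol_def
    by (intro measure_mono_fmeasurable cball_subset_cell assms fmeasurable_compact compact_cell) auto
  finally show ?thesis .
qed

text \<open>The density in the kernel of the main estimate involves \<open>cell_vol v\<close>, so its measurability is needed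
  for the exchange of integrals.\<close>

lemma borel_measurable_cell_vol [measurable]: "cell_vol \<in> borel_measurable borel"
proof -
  have "{p. snd p \<in> cell (fst p)} \<in> sets (borel \<Otimes>\<^sub>M borel :: ((complex ^ 'n) \<times> (complex ^ 'n)) measure)"
    unfolding borel_prod by (rule borel_closed[OF closed_cell_graph])
  then have "{p. snd p \<in> cell (fst p)} \<in> sets (borel \<Otimes>\<^sub>M lborel :: ((complex ^ 'n) \<times> (complex ^ 'n)) measure)"
    by (simp cong: sets_pair_measure_cong)
  from lborel.measurable_emeasure_Pair[OF this]
  have "(\<lambda>w. emeasure lborel (cell w)) \<in> borel_measurable (borel :: (complex ^ 'n) measure)"
    by (simp add: vimage_def)
  then show ?thesis unfolding cell_vol_def measure_def by measurable
qed

lemma emeasure_affine_image_cell: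
  assumes "L > 0"
  shows "emeasure lborel ((\<lambda>u. L *\<^sub>R u + w) ` cell v) = ennreal (L ^ DIM(complex ^ 'n) * cell_vol v)"
    and "(\<lambda>u. L *\<^sub>R u + w) ` cell (v :: complex ^ 'n) \<in> sets borel"
proof -
  have "compact ((\<lambda>u. L *\<^sub>R u + w) ` cell v)"
    by (intro compact_continuous_image compact_cell continuous_intros)
  then show s: "(\<lambda>u. L *\<^sub>R u + w) ` cell v \<in> sets borel" by (simp add: borel_compact)
  then have "emeasure lborel ((\<lambda>u. L *\<^sub>R u + w) ` cell v) = emeasure lebesgue ((\<lambda>u. L *\<^sub>R u + w) ` cell v)"
    by simp
  also have "\<dots> = \<bar>L\<bar> ^ DIM(complex ^ 'n) * emeasure lebesgue (cell v)"
    by (rule emeasure_lebesgue_affine)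
  also have "\<dots> = ennreal (L ^ DIM(complex ^ 'n) * cell_vol v)"
    using assms by (simp add: emeasure_cell ennreal_power ennreal_mult cell_vol_def)
  finally show "emeasure lborel ((\<lambda>u. L *\<^sub>R u + w) ` cell v) = ennreal (L ^ DIM(complex ^ 'n) * cell_vol v)" .
qed

lemma emeasure_near_le:
  fixes w :: "complex ^ 'n"
  assumes w: "norm w < 1" and K: "K \<ge> 0"
  shows "emeasure lborel {z. norm z < 1 \<and> near K z w}
    \<le> ennreal ((16 * K + 4) ^ DIM(complex ^ 'n) * cell_vol w)"
proof -
  have "{z. norm z < 1 \<and> near K z w} \<subseteq> (\<lambda>u. (16 * K + 4) *\<^sub>R u + w) ` cell w"
  proof
    fix z assume "z \<in> {z. norm z < 1 \<and> near K z w}"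
    then obtain u where "u \<in> cell w" "z = (16 * K + 4) *\<^sub>R u + w"
      using near_in_dilated_cell[OF _ w _ K, of z] by auto
    then show "z \<in> (\<lambda>u. (16 * K + 4) *\<^sub>R u + w) ` cell w" by (rule rev_image_eqI)
  qed
  then have "emeasure lborel {z. norm z < 1 \<and> near K z w}
      \<le> emeasure lborel ((\<lambda>u. (16 * K + 4) *\<^sub>R u + w) ` cell w)"
    using K emeasure_affine_image_cell(2)[of "16 * K + 4" w w] by (intro emeasure_mono) auto
  also have "\<dots> = ennreal ((16 * K + 4) ^ DIM(complex ^ 'n) * cell_vol w)"
    using K by (intro emeasure_affine_image_cell(1)) auto
  finally show ?thesis .
qed

text \<open>The constant of \<open>near_trans\<close>.\<close>

definition trans_const :: "real \<Rightarrow> real" where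
  "trans_const K = (16 * K * (3 * K + 1))\<^sup>2"

text \<open>The translate \<open>z + cell z\<close> consists of points near \<open>z\<close>, hence near \<open>w\<close>, hence lies in a dilate of
  the cell of \<open>w\<close>.\<close>

lemma cell_vol_le:
  fixes w z :: "complex ^ 'n"
  assumes z: "norm z < 1" and w: "norm w < 1" and n: "near K z w" and K: "K \<ge> 4"
  shows "cell_vol z \<le> (16 * trans_const K + 4) ^ DIM(complex ^ 'n) * cell_vol w"
proof -
  define L where "L = 16 * trans_const K + 4"
  have T: "trans_const K \<ge> 0" by (simp add: trans_const_def)
  have "(\<lambda>u. 1 *\<^sub>R u + z) ` cell z \<subseteq> {v. norm v < 1 \<and> near (trans_const K) v w}"
  proof safe
    fix u assume u: "u \<in> cell z"
    then show b: "norm (1 *\<^sub>R u + z) < 1" using cell_in_ball(1)[OF z u] by (simp add: add.commute)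
    have "near K (1 *\<^sub>R u + z) z"
      using near_mono[OF cell_in_ball(2)[OF z u] K cell_in_ball(1)[OF z u] z] by (simp add: add.commute)
    then show "near (trans_const K) (1 *\<^sub>R u + z) w" unfolding trans_const_def
      using near_trans[OF b z w] n K by (simp add: near_commute)
  qed
  then have "emeasure lborel ((\<lambda>u. 1 *\<^sub>R u + z) ` cell z) \<le> emeasure lborel {v. norm v < 1 \<and> near (trans_const K) v w}"
    by (intro emeasure_mono) measurable
  also have "\<dots> \<le> ennreal (L ^ DIM(complex ^ 'n) * cell_vol w)"
    unfolding L_def by (rule emeasure_near_le[OF w T])
  finally have "ennreal (cell_vol z) \<le> ennreal (L ^ DIM(complex ^ 'n) * cell_vol w)"
    by (subst (asm) emeasure_affine_image_cell(1)) simp_all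
  then show ?thesis using T cell_vol_pos[OF w] by (subst (asm) ennreal_le_iff) (simp_all add: L_def)
qed

text \<open>The exponent may be negative, so the comparison of defects is needed in both directions.\<close>

lemma defect_powr_le:
  assumes z: "norm z < 1" and w: "norm w < 1" and n: "near K z w" and K: "K \<ge> 0"
  shows "defect z powr \<alpha> \<le> (4 * K) powr \<bar>\<alpha>\<bar> * defect w powr \<alpha>"
proof -
  have pos: "defect z > 0" "defect w > 0" using z w by (simp_all add: defect_bounds)
  have zw: "defect z \<le> 4 * K * defect w" and wz: "defect w \<le> 4 * K * defect z"
    using near_defect_le[OF z w n] near_defect_le[OF w z, of K] n by (simp_all add: near_commute)
  show ?thesis
  proof (cases "\<alpha> \<ge> 0")
    case True
    then have "defect z powr \<alpha> \<le> (4 * K * defect w) powr \<alpha>" using pos zw by (intro powr_mono2) auto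
    then show ?thesis using True pos K by (simp add: powr_mult)
  next
    case False
    have "defect w powr (- \<alpha>) \<le> (4 * K * defect z) powr (- \<alpha>)"
      using pos wz False by (intro powr_mono2) auto
    also have "\<dots> = (4 * K) powr (- \<alpha>) * defect z powr (- \<alpha>)" using pos K by (simp add: powr_mult)
    finally have "defect w powr (- \<alpha>) * (defect z powr \<alpha> * defect w powr \<alpha>)
        \<le> (4 * K) powr (- \<alpha>) * defect z powr (- \<alpha>) * (defect z powr \<alpha> * defect w powr \<alpha>)"
      by (intro mult_right_mono) auto
    then show ?thesis using pos False by (simp add: powr_minus field_simps)
  qed
qed

lemma borel_measurable_norm_powr:
  fixes f :: "complex ^ 'n \<Rightarrow> complex"
  assumes "f \<in> holomorphic_functions unit_ball" and "p > 0"
  shows "(\<lambda>v. ennreal (cmod (f v) powr p) * indicator (ball 0 1) v) \<in> borel_measurable borel"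
proof -
  have [measurable]: "(\<lambda>v. indicator (ball 0 1) v *\<^sub>R f v) \<in> borel_measurable borel"
    by (intro borel_measurable_continuous_on_indicator holomorphic_functions_continuous_on assms) simp
  have "(\<lambda>v. ennreal (cmod (indicator (ball 0 1) v *\<^sub>R f v) powr p)) \<in> borel_measurable borel"
    by measurable
  also have "(\<lambda>v. ennreal (cmod (indicator (ball 0 1) v *\<^sub>R f v) powr p))
      = (\<lambda>v. ennreal (cmod (f v) powr p) * indicator (ball 0 1) v)"
    using assms(2) by (auto simp: indicator_def)
  finally show ?thesis .
qed

text \<open>The sub-mean value inequality on \<open>w + cell w\<close>, which lies in the set of points near \<open>w\<close>.\<close>

lemma norm_powr_cell_le:
  fixes f :: "complex ^ 'n \<Rightarrow> complex"
  assumes w: "norm w < 1" and f: "f \<in> holomorphic_functions unit_ball" and p: "0 < p" "p \<le> real m"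
  shows "ennreal (cmod (f w) powr p) * ennreal (cell_vol w)
    \<le> ennreal (2 powr (real DIM(complex ^ 'n) * real m / p))
      * (\<integral>\<^sup>+v. ennreal (cmod (f v) powr p) * indicator {v. norm v < 1 \<and> near 4 v w} v \<partial>lborel)"
proof -
  define d where "d = defect w"
  have d: "d > 0" using w by (simp add: d_def defect_bounds)
  define q where "q u = max (4 / d * cmod (herm u w)) (4 / sqrt d * norm u)" for u
  have q_le: "{u. q u \<le> 1} = cell w"
  proof -
    have "4 / sqrt d * norm u \<le> 1 \<longleftrightarrow> (norm u)\<^sup>2 \<le> d / 16" for u :: "complex ^ 'n"
    proof -
      have "4 / sqrt d * norm u \<le> 1 \<longleftrightarrow> norm u \<le> sqrt (d / 16)"
        using d by (simp add: field_simps real_sqrt_divide)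
      also have "\<dots> \<longleftrightarrow> (norm u)\<^sup>2 \<le> d / 16"
        using d by (metis norm_ge_zero real_le_rsqrt real_sqrt_le_iff real_sqrt_abs abs_of_nonneg)
      finally show ?thesis .
    qed
    then show ?thesis using d by (auto simp: q_def cell_def d_def[symmetric] field_simps)
  qed
  define G where "G v = ennreal (cmod (f v) powr p) * indicator {v. norm v < 1 \<and> near 4 v w} v" for v
  have G [measurable]: "G \<in> borel_measurable borel"
  proof -
    note [measurable] = borel_measurable_norm_powr[OF f p(1)]
    have "(\<lambda>v. ennreal (cmod (f v) powr p) * indicator (ball 0 1) v * indicator {v. near 4 v w} v)
        \<in> borel_measurable borel" by measurable
    also have "(\<lambda>v. ennreal (cmod (f v) powr p) * indicator (ball 0 1) v * indicator {v. near 4 v w} v) = G"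
      by (auto simp: G_def fun_eq_iff indicator_def)
    finally show ?thesis .
  qed
  have "ennreal (cmod (f w) powr p) * emeasure lborel {u. q u \<le> 1}
    \<le> ennreal (2 powr (real DIM(complex ^ 'n) * real m / p))
      * (\<integral>\<^sup>+u. ennreal (cmod (f (w + u)) powr p) * indicator {u. q u \<le> 1} u \<partial>lborel)"
  proof (rule power_mean_value[OF _ _ _ _ open_ball f _ p])
    show "continuous_on UNIV q" unfolding q_def using d by (intro continuous_intros) auto
    show "q (u + v) \<le> q u + q v" for u v
    proof -
      have "4 / d * cmod (herm (u + v) w) \<le> 4 / d * (cmod (herm u w) + cmod (herm v w))"
        using d by (intro mult_left_mono) (auto simp: herm_add_left norm_triangle_ineq)
      moreover have "4 / sqrt d * norm (u + v) \<le> 4 / sqrt d * (norm u + norm v)"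
        using d by (intro mult_left_mono norm_triangle_ineq) auto
      ultimately show ?thesis unfolding q_def distrib_left by linarith
    qed
    show "q (c *s u) = cmod c * q u" for c u
      by (simp add: q_def herm_smult_left norm_mult norm_vec_smult max_mult_distrib_left mult_ac)
    show "bounded {u. q u \<le> 1}" unfolding q_le by (rule compact_imp_bounded[OF compact_cell])
    show "w + u \<in> ball 0 1" if "q u \<le> 1" for u
      using that q_le cell_in_ball(1)[OF w, of u] by auto
  qed
  also have "(\<integral>\<^sup>+u. ennreal (cmod (f (w + u)) powr p) * indicator {u. q u \<le> 1} u \<partial>lborel)
      \<le> (\<integral>\<^sup>+u. G (w + u) \<partial>lborel)"
    by (intro nn_integral_mono) (auto simp: G_def q_le indicator_def cell_in_ball[OF w])
  also have "\<dots> = (\<integral>\<^sup>+v. G v \<partial>lborel)" by (rule nn_integral_lborel_translate[OF G])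
  finally show ?thesis unfolding q_le emeasure_cell G_def by (simp add: mult_left_mono)
qed

section \<open>The integral of the maximal function\<close>

lemma ennpowr_mono: "x \<le> y \<Longrightarrow> 0 < q \<Longrightarrow> ennpowr x q \<le> ennpowr y q"
  unfolding ennpowr_def
  by (auto simp: less_top intro!: ennreal_leI powr_mono2 enn2real_mono)

lemma ennpowr_ennreal: "0 \<le> x \<Longrightarrow> ennpowr (ennreal x) q = ennreal (x powr q)"
  by (simp add: ennpowr_def)

lemma ennpowr_cmult:
  assumes "c > 0"
  shows "ennpowr (ennreal c * x) q = ennreal (c powr q) * ennpowr x q"
proof (cases x)
  case (real r)
  then show ?thesis using assms by (simp add: ennpowr_ennreal powr_mult flip: ennreal_mult)
next
  case top
  then show ?thesis using assms by (simp add: ennpowr_def ennreal_mult_top)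
qed

lemma ennpowr_SUP_le:
  assumes p: "p > 0" and le: "\<And>w. w \<in> A \<Longrightarrow> ennreal (cmod (g w) powr p) \<le> b"
  shows "ennpowr (SUP w\<in>A. ennreal (cmod (g w))) p \<le> b"
proof (cases b)
  case (real r)
  have "(SUP w\<in>A. ennreal (cmod (g w))) \<le> ennreal (r powr (1 / p))"
  proof (intro SUP_least ennreal_leI)
    fix w assume "w \<in> A"
    then have "cmod (g w) powr p \<le> r" using le real by simp
    then have "(cmod (g w) powr p) powr (1 / p) \<le> r powr (1 / p)" using p by (intro powr_mono2) auto
    then show "cmod (g w) \<le> r powr (1 / p)" using p by (simp add: powr_powr)
  qed
  then have "ennpowr (SUP w\<in>A. ennreal (cmod (g w))) p \<le> ennpowr (ennreal (r powr (1 / p))) p"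
    using p by (intro ennpowr_mono)
  also have "\<dots> = b" using p real by (simp add: ennpowr_ennreal powr_powr)
  finally show ?thesis .
qed simp

lemma borel_measurable_ennpowr [measurable]:
  assumes [measurable]: "g \<in> borel_measurable M"
  shows "(\<lambda>x. ennpowr (g x) p) \<in> borel_measurable M"
proof -
  have [measurable]: "Measurable.pred M (\<lambda>x. g x = \<infinity>)"
    using measurable_sets[of g M borel "{\<infinity>}"] assms
    by (simp add: pred_def vimage_def Int_def conj_commute)
  have [measurable]: "(\<lambda>x. enn2real (g x) powr p) \<in> borel_measurable M"
    by measurable
  show ?thesis unfolding ennpowr_def by measurable
qed

lemma near_if_bergman_ball:
  assumes "norm z < 1" "w \<in> bergman_ball z \<gamma>"
  shows "near (1 / (1 - (tanh \<gamma>)\<^sup>2)) w z"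
proof -
  have w: "norm w < 1" using assms by (simp add: bergman_ball_def)
  have "(tanh \<gamma>)\<^sup>2 < 1" using tanh_real_bounds[of \<gamma>] by (simp add: abs_square_less_1 abs_if)
  moreover have "(1 - (tanh \<gamma>)\<^sup>2) * (cmod (1 - herm w z))\<^sup>2 < defect z * defect w"
    using bergman_ball_iff[OF assms(1) w] assms(2) by simp
  ultimately show ?thesis unfolding near_def by (simp add: field_simps)
qed

lemma borel_measurable_defect [measurable]: "defect \<in> borel_measurable borel"
  by (intro borel_measurable_continuous_onI continuous_intros)

text \<open>Of the constants in the proof, \<open>K\<close> is such that all points of a Bergman ball are \<open>near K\<close> its centre,
  and \<open>T\<close> comes from one use of the triangle inequality. \<open>C1\<close> is the constant of the mean value
  inequality, \<open>C2\<close> and \<open>C3\<close> compare cell volumes at points that are \<open>near K\<close> and \<open>near T\<close>, and \<open>C4\<close>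
  compares the weights. The constant \<open>C2\<close> occurs once more at the end as the ratio between the volume of
  the set of points near \<open>v\<close> and that of the cell of \<open>v\<close>.\<close>

lemma maximal_integral_le:
  fixes \<gamma> \<alpha> p :: real
  assumes p: "p > 0"
  shows "\<exists>C > 0. \<forall>f \<in> holomorphic_functions (unit_ball :: (complex ^ 'n) set).
    (\<integral>\<^sup>+z. ennpowr (maximal_fun \<gamma> f z) p * ennreal (defect z powr \<alpha>) * indicator unit_ball z \<partial>lborel)
    \<le> ennreal C * (\<integral>\<^sup>+z. ennreal (cmod (f z) powr p) * ennreal (defect z powr \<alpha>) * indicator unit_ball z \<partial>lborel)"
proof -
  define m where "m = nat \<lceil>p\<rceil>"
  have m: "p \<le> real m" unfolding m_def by linarith
  define N where "N = DIM(complex ^ 'n)"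
  define K where "K = max 4 (1 / (1 - (tanh \<gamma>)\<^sup>2))"
  define T where "T = trans_const K"
  have K: "K \<ge> 4" by (simp add: K_def)
  have T: "T \<ge> 4"
  proof -
    have "2\<^sup>2 \<le> (16 * K * (3 * K + 1))\<^sup>2"
      using K mult_mono[of 2 "16 * K" 1 "3 * K + 1"] by (intro power_mono) auto
    then show ?thesis by (simp add: T_def trans_const_def)
  qed
  define C1 C2 C3 C4 where "C1 = 2 powr (real N * real m / p)" and "C2 = (16 * T + 4) ^ N"
    and "C3 = (16 * trans_const T + 4) ^ N" and "C4 = (4 * T) powr \<bar>\<alpha>\<bar>"
  have pos: "C1 > 0" "C2 > 0" "C3 > 0" "C4 > 0"
    using T by (auto simp: C1_def C2_def C3_def C4_def trans_const_def add_nonneg_pos)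
  define C where "C = C1 * C2 * C4 * C3"
  have C: "C > 0" using pos by (simp add: C_def)
  show ?thesis
  proof (intro exI conjI ballI)
    show "C * C2 > 0" using C pos by simp
    fix f :: "complex ^ 'n \<Rightarrow> complex" assume f: "f \<in> holomorphic_functions unit_ball"
    define F where "F v = ennreal (cmod (f v) powr p) * indicator (ball 0 1) v" for v
    have [measurable]: "F \<in> borel_measurable borel"
      unfolding F_def by (rule borel_measurable_norm_powr[OF f p])
    have [measurable]: "(unit_ball :: (complex ^ 'n) set) \<in> sets borel" by simp
    define H where "H v = ennreal (C * defect v powr \<alpha> / cell_vol v) * F v" for v
    have [measurable]: "H \<in> borel_measurable borel" unfolding H_def by measurable
    \<comment> \<open>A bound that does not depend on the point \<open>w\<close> of the Bergman ball, so that it passes to the supremum.\<close>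
    define R where "R z = (\<integral>\<^sup>+v. H v * indicator {v. near T v z} v \<partial>lborel)" for z
    have pointwise: "ennreal (cmod (f w) powr p) * ennreal (defect z powr \<alpha>) \<le> R z"
      if z: "norm z < 1" and w: "w \<in> bergman_ball z \<gamma>" for z w
    proof -
      have w1: "norm w < 1" using w by (simp add: bergman_ball_def)
      have wz: "near K w z"
        by (rule near_mono[OF near_if_bergman_ball[OF z w] _ w1 z]) (simp add: K_def)
      have V: "cell_vol z > 0" by (rule cell_vol_pos[OF z])
      define I where "I = (\<integral>\<^sup>+v. F v * indicator {v. near T v z} v \<partial>lborel)"
      have "ennreal (cmod (f w) powr p) * ennreal (cell_vol w)
          \<le> ennreal C1 * (\<integral>\<^sup>+v. ennreal (cmod (f v) powr p) * indicator {v. norm v < 1 \<and> near 4 v w} v \<partial>lborel)"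
        unfolding C1_def N_def by (rule norm_powr_cell_le[OF w1 f p m])
      also have "(\<integral>\<^sup>+v. ennreal (cmod (f v) powr p) * indicator {v. norm v < 1 \<and> near 4 v w} v \<partial>lborel) \<le> I"
        unfolding I_def
      proof (intro nn_integral_mono)
        fix v
        have "near T v z" if "norm v < 1" "near 4 v w"
          unfolding T_def trans_const_def
          by (rule near_trans[OF that(1) w1 z near_mono[OF that(2) K that(1) w1]])
             (use wz K in \<open>auto simp: near_commute\<close>)
        then show "ennreal (cmod (f v) powr p) * indicator {v. norm v < 1 \<and> near 4 v w} v
            \<le> F v * indicator {v. near T v z} v"
          by (auto simp: F_def indicator_def)
      qed
      finally have w_est: "ennreal (cmod (f w) powr p) * ennreal (cell_vol w) \<le> ennreal C1 * I"
        by (simp add: mult_left_mono)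
      have "cell_vol z \<le> C2 * cell_vol w" unfolding C2_def N_def T_def
        by (rule cell_vol_le[OF z w1 _ K]) (use wz in \<open>simp add: near_commute\<close>)
      then have "ennreal (cmod (f w) powr p) * ennreal (cell_vol z)
          \<le> ennreal (cmod (f w) powr p) * (ennreal C2 * ennreal (cell_vol w))"
        using pos cell_vol_pos[OF w1] by (intro mult_left_mono) (auto simp flip: ennreal_mult intro: ennreal_leI)
      also have "\<dots> \<le> ennreal C2 * (ennreal C1 * I)"
        using mult_left_mono[OF w_est, of "ennreal C2"] by (simp add: mult_ac)
      finally have z_est: "ennreal (cmod (f w) powr p) * ennreal (cell_vol z) \<le> ennreal C2 * (ennreal C1 * I)" .
      have "ennreal (cmod (f w) powr p) * ennreal (defect z powr \<alpha>)
          = ennreal (cmod (f w) powr p) * ennreal (cell_vol z) * ennreal (defect z powr \<alpha> / cell_vol z)"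
        using V by (simp flip: ennreal_mult)
      also have "\<dots> \<le> ennreal C2 * (ennreal C1 * I) * ennreal (defect z powr \<alpha> / cell_vol z)"
        by (intro mult_right_mono z_est) simp
      also have "\<dots> = ennreal (C1 * C2 * defect z powr \<alpha> / cell_vol z) * I"
        using pos V by (simp add: ennreal_mult mult_ac flip: times_divide_eq_right)
      also have "\<dots> = (\<integral>\<^sup>+v. ennreal (C1 * C2 * defect z powr \<alpha> / cell_vol z) * (F v * indicator {v. near T v z} v) \<partial>lborel)"
        unfolding I_def by (intro nn_integral_cmult[symmetric]) measurable
      also have "\<dots> \<le> R z" unfolding R_def
      proof (intro nn_integral_mono)
        fix v
        have "C1 * C2 * defect z powr \<alpha> / cell_vol z \<le> C * defect v powr \<alpha> / cell_vol v"
          if v: "norm v < 1" and n: "near T v z"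
        proof -
          have Vv: "cell_vol v > 0" by (rule cell_vol_pos[OF v])
          have "cell_vol v \<le> C3 * cell_vol z" unfolding C3_def N_def
            by (rule cell_vol_le[OF v z n T])
          then have 1: "1 / cell_vol z \<le> C3 / cell_vol v" using V Vv by (simp add: field_simps)
          have "defect z powr \<alpha> \<le> C4 * defect v powr \<alpha>" unfolding C4_def
            by (rule defect_powr_le[OF z v]) (use n T in \<open>auto simp: near_commute\<close>)
          then have "C1 * C2 * (defect z powr \<alpha>) * (1 / cell_vol z)
              \<le> C1 * C2 * (C4 * defect v powr \<alpha>) * (C3 / cell_vol v)"
            using pos V 1 by (intro mult_mono) auto
          then show ?thesis by (simp add: C_def mult_ac)
        qed
        then show "ennreal (C1 * C2 * defect z powr \<alpha> / cell_vol z) * (F v * indicator {v. near T v z} v)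
            \<le> H v * indicator {v. near T v z} v"
          by (auto simp: H_def F_def indicator_def intro!: mult_right_mono ennreal_leI)
      qed
      finally show ?thesis .
    qed
    have maximal: "ennpowr (maximal_fun \<gamma> f z) p * ennreal (defect z powr \<alpha>) \<le> R z" if z: "norm z < 1" for z
    proof -
      define e where "e = defect z powr \<alpha>"
      have e: "e > 0" using defect_bounds(1)[OF z] by (simp add: e_def)
      have cancel: "ennreal (1 / e) * (x * ennreal e) = x" for x
        using e by (simp add: mult.left_commute[of _ x] flip: ennreal_mult)
      have "ennpowr (maximal_fun \<gamma> f z) p \<le> ennreal (1 / e) * R z"
        unfolding maximal_fun_def
      proof (rule ennpowr_SUP_le[OF p])
        fix w assume "w \<in> bergman_ball z \<gamma>"
        from mult_left_mono[OF pointwise[OF z this], of "ennreal (1 / e)"]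
        show "ennreal (cmod (f w) powr p) \<le> ennreal (1 / e) * R z"
          by (simp add: cancel flip: e_def)
      qed
      then have "ennpowr (maximal_fun \<gamma> f z) p * ennreal e \<le> ennreal (1 / e) * R z * ennreal e"
        by (rule mult_right_mono) simp
      then show ?thesis by (simp add: cancel mult.assoc flip: e_def)
    qed
    have "(\<integral>\<^sup>+z. ennpowr (maximal_fun \<gamma> f z) p * ennreal (defect z powr \<alpha>) * indicator unit_ball z \<partial>lborel)
        \<le> (\<integral>\<^sup>+z. \<integral>\<^sup>+v. H v * indicator {v. near T v z} v * indicator unit_ball z \<partial>lborel \<partial>lborel)"
    proof (intro nn_integral_mono)
      fix z :: "complex ^ 'n"
      have "(\<integral>\<^sup>+v. H v * indicator {v. near T v z} v * indicator unit_ball z \<partial>lborel) = R z * indicator unit_ball z"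
        unfolding R_def by (intro nn_integral_multc) measurable
      then show "ennpowr (maximal_fun \<gamma> f z) p * ennreal (defect z powr \<alpha>) * indicator unit_ball z
          \<le> (\<integral>\<^sup>+v. H v * indicator {v. near T v z} v * indicator unit_ball z \<partial>lborel)"
        using maximal[of z] by (auto simp: indicator_def)
    qed
    \<comment> \<open>By symmetry of the relation, the inner integral now is the volume of the set of points near \<open>v\<close>.\<close>
    also have "\<dots> = (\<integral>\<^sup>+v. \<integral>\<^sup>+z. H v * indicator {v. near T v z} v * indicator unit_ball z \<partial>lborel \<partial>lborel)"
      by (intro lborel_pair.Fubini') measurable
    also have "\<dots> \<le> (\<integral>\<^sup>+v. ennreal (C * C2) * (ennreal (cmod (f v) powr p) * ennreal (defect v powr \<alpha>) * indicator unit_ball v) \<partial>lborel)"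
    proof (intro nn_integral_mono)
      fix v :: "complex ^ 'n"
      show "(\<integral>\<^sup>+z. H v * indicator {v. near T v z} v * indicator unit_ball z \<partial>lborel)
          \<le> ennreal (C * C2) * (ennreal (cmod (f v) powr p) * ennreal (defect v powr \<alpha>) * indicator unit_ball v)"
      proof (cases "norm v < 1")
        case False
        then show ?thesis by (simp add: H_def F_def)
      next
        case True
        then have V: "cell_vol v > 0" by (rule cell_vol_pos)
        have "(\<integral>\<^sup>+z. H v * indicator {v. near T v z} v * indicator unit_ball z \<partial>lborel)
            = (\<integral>\<^sup>+z. H v * indicator {z. norm z < 1 \<and> near T z v} z \<partial>lborel)"
          by (intro nn_integral_cong) (auto simp: indicator_def near_commute)
        also have "\<dots> = H v * emeasure lborel {z. norm z < 1 \<and> near T z v}"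
          by (intro nn_integral_cmult_indicator) measurable
        also have "\<dots> \<le> H v * ennreal (C2 * cell_vol v)"
          unfolding C2_def N_def using T by (intro mult_left_mono emeasure_near_le True) auto
        also have "\<dots> = ennreal (C * defect v powr \<alpha> / cell_vol v) * ennreal (C2 * cell_vol v) * ennreal (cmod (f v) powr p)"
          using True by (simp add: H_def F_def mult_ac)
        also have "\<dots> = ennreal (C * C2 * defect v powr \<alpha>) * ennreal (cmod (f v) powr p)"
          using V C pos by (simp add: mult_ac flip: ennreal_mult)
        also have "\<dots> = ennreal (C * C2) * (ennreal (cmod (f v) powr p) * ennreal (defect v powr \<alpha>) * indicator unit_ball v)"
          using True C pos by (simp add: ennreal_mult mult_ac)
        finally show ?thesis .
      qed
    qed
    also have "\<dots> = ennreal (C * C2) * (\<integral>\<^sup>+v. ennreal (cmod (f v) powr p) * ennreal (defect v powr \<alpha>) * indicator unit_ball v \<partial>lborel)"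
    proof (intro nn_integral_cmult)
      have "(\<lambda>v. F v * ennreal (defect v powr \<alpha>)) \<in> borel_measurable lborel" by measurable
      then show "(\<lambda>v. ennreal (cmod (f v) powr p) * ennreal (defect v powr \<alpha>) * indicator unit_ball v) \<in> borel_measurable lborel"
        unfolding F_def by (simp add: mult_ac)
    qed
    finally show "(\<integral>\<^sup>+z. ennpowr (maximal_fun \<gamma> f z) p * ennreal (defect z powr \<alpha>) * indicator unit_ball z \<partial>lborel)
      \<le> ennreal (C * C2) * (\<integral>\<^sup>+z. ennreal (cmod (f z) powr p) * ennreal (defect z powr \<alpha>) * indicator unit_ball z \<partial>lborel)" .
  qed
qed

section \<open>Norms with respect to the weighted measure\<close>

lemma sets_weighted_measure:
  "sets (weighted_measure \<alpha> :: (complex ^ 'n) measure) = sets (restrict_space lebesgue unit_ball)"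
  by (simp add: weighted_measure_def ball_measure_def)

lemma space_weighted_measure: "space (weighted_measure \<alpha> :: (complex ^ 'n) measure) = unit_ball"
  using sets_eq_imp_space_eq[OF sets_weighted_measure] by (simp add: space_restrict_space)

text \<open>The weighted measure lives on the completed sigma-algebra of the ball, but all functions in
  question are Borel measurable there.\<close>

lemma borel_measurable_weighted_measure:
  fixes g :: "complex ^ 'n \<Rightarrow> ennreal"
  assumes "(\<lambda>z. g z * indicator unit_ball z) \<in> borel_measurable borel"
  shows "g \<in> borel_measurable (weighted_measure \<alpha>)"
proof -
  have "(\<lambda>z. g z * indicator unit_ball z) \<in> borel_measurable lebesgue"
    using assms by (intro measurable_completion) simp
  then have "g \<in> borel_measurable (restrict_space lebesgue unit_ball)"
    by (subst borel_measurable_restrict_space_iff_ennreal) auto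
  then show ?thesis by (simp cong: measurable_cong_sets add: measurable_cong_sets[OF sets_weighted_measure refl])
qed

lemma nn_integral_weighted_measure:
  assumes "\<alpha> > -1"
  shows "\<exists>c > 0. \<forall>g :: complex ^ 'n \<Rightarrow> ennreal.
    (\<lambda>z. g z * indicator unit_ball z) \<in> borel_measurable borel \<longrightarrow>
    (\<integral>\<^sup>+z. g z \<partial>weighted_measure \<alpha>)
      = ennreal c * (\<integral>\<^sup>+z. g z * ennreal (defect z powr \<alpha>) * indicator unit_ball z \<partial>lborel)"
proof (intro exI conjI allI impI)
  define k where "k = weight_const TYPE('n) \<alpha>"
  define vol where "vol = measure lebesgue (unit_ball :: (complex ^ 'n) set)"
  have k: "k > 0" unfolding k_def weight_const_def using assms
    by (intro divide_pos_pos mult_pos_pos Gamma_real_pos) (auto intro: add_nonneg_pos)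
  have vol: "vol > 0" unfolding vol_def using content_ball_pos[of 1 "0 :: complex ^ 'n"] by simp
  have e_vol: "emeasure lebesgue (unit_ball :: (complex ^ 'n) set) = ennreal vol"
    unfolding vol_def using emeasure_lborel_ball_finite[of "0 :: complex ^ 'n" 1]
    by (intro emeasure_eq_ennreal_measure) auto
  show "k / vol > 0" using k vol by simp
  fix g :: "complex ^ 'n \<Rightarrow> ennreal"
  assume g: "(\<lambda>z. g z * indicator unit_ball z) \<in> borel_measurable borel"
  define d where "d z = ennreal (k * defect z powr \<alpha>)" for z :: "complex ^ 'n"
  have d [measurable]: "d \<in> borel_measurable borel" unfolding d_def by measurable
  have [measurable]: "(unit_ball :: (complex ^ 'n) set) \<in> sets borel" by simp
  have "(\<lambda>z. d z * (g z * indicator unit_ball z)) \<in> borel_measurable borel" using g by measurable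
  then have dg: "(\<lambda>z. d z * g z) \<in> borel_measurable (weighted_measure \<alpha>)"
    by (intro borel_measurable_weighted_measure) (simp add: mult.assoc)
  have dm: "d \<in> borel_measurable (weighted_measure \<alpha>)"
    by (intro borel_measurable_weighted_measure) measurable
  have gm: "g \<in> borel_measurable (weighted_measure \<alpha>)" by (rule borel_measurable_weighted_measure[OF g])
  note cong = measurable_cong_sets[OF sets_weighted_measure refl, of \<alpha>]
  have ball_cong: "borel_measurable ball_measure = borel_measurable (restrict_space lebesgue (unit_ball :: (complex ^ 'n) set))"
    by (intro measurable_cong_sets) (simp_all add: ball_measure_def)
  have "(\<integral>\<^sup>+z. g z \<partial>weighted_measure \<alpha>) = (\<integral>\<^sup>+z. d z * g z \<partial>ball_measure)"
    unfolding weighted_measure_def k_def[symmetric] defect_def[symmetric] d_def[symmetric]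
    using dm gm by (intro nn_integral_density) (simp_all add: ball_cong cong)
  also have "\<dots> = 1 / ennreal vol * (\<integral>\<^sup>+z. d z * g z \<partial>restrict_space lebesgue unit_ball)"
    unfolding ball_measure_def e_vol using dg by (intro nn_integral_scale_measure) (simp add: cong)
  also have "(\<integral>\<^sup>+z. d z * g z \<partial>restrict_space lebesgue unit_ball)
      = (\<integral>\<^sup>+z. d z * g z * indicator unit_ball z \<partial>lborel)"
    by (simp add: nn_integral_restrict_space nn_integral_completion)
  also have "\<dots> = (\<integral>\<^sup>+z. ennreal k * (g z * ennreal (defect z powr \<alpha>) * indicator unit_ball z) \<partial>lborel)"
    using k by (intro nn_integral_cong) (simp add: d_def ennreal_mult mult_ac)
  also have "\<dots> = ennreal k * (\<integral>\<^sup>+z. g z * ennreal (defect z powr \<alpha>) * indicator unit_ball z \<partial>lborel)"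
  proof (intro nn_integral_cmult)
    have "(\<lambda>z. (g z * indicator unit_ball z) * ennreal (defect z powr \<alpha>)) \<in> borel_measurable lborel"
      using g by measurable
    then show "(\<lambda>z. g z * ennreal (defect z powr \<alpha>) * indicator unit_ball z) \<in> borel_measurable lborel"
      by (simp add: mult_ac)
  qed
  finally show "(\<integral>\<^sup>+z. g z \<partial>weighted_measure \<alpha>)
      = ennreal (k / vol) * (\<integral>\<^sup>+z. g z * ennreal (defect z powr \<alpha>) * indicator unit_ball z \<partial>lborel)"
    using k vol divide_ennreal[of 1 vol] by (simp flip: mult.assoc ennreal_mult)
qed

text \<open>The Bergman metric depends continuously on its first argument \<open>z\<close> although the automorphism does not:
  its projection part is discontinuous at \<open>z = 0\<close>. The description of the Bergman ball by
  an inequality between continuous functions of \<open>z\<close> avoids this.\<close>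

lemma open_bergman_ball_section:
  assumes w: "norm w < 1"
  shows "open {z \<in> unit_ball. w \<in> bergman_ball z \<gamma>}"
proof -
  have "{z \<in> unit_ball. w \<in> bergman_ball z \<gamma>} = unit_ball \<inter>
     {z. 0 < \<gamma> \<and> (1 - (tanh \<gamma>)\<^sup>2) * (cmod (1 - herm w z))\<^sup>2 < defect z * defect w}"
    using w by (auto simp: bergman_ball_iff)
  also have "open \<dots>"
    by (intro open_Int open_ball open_Collect_conj open_Collect_less open_Collect_const continuous_intros)
  finally show ?thesis .
qed

text \<open>The maximal function is lower semicontinuous on the ball for every \<open>f\<close>: the superlevel sets are
  unions of open sections.\<close>

lemma borel_measurable_maximal_fun:
  "(\<lambda>z. maximal_fun \<gamma> f z * indicator unit_ball z) \<in> borel_measurable borel"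
proof (rule borel_measurableI_greater)
  fix t :: ennreal
  have "{z. t < maximal_fun \<gamma> f z * indicator unit_ball z}
      = (\<Union>w\<in>{w. norm w < 1 \<and> t < ennreal (cmod (f w))}. {z \<in> unit_ball. w \<in> bergman_ball z \<gamma>})"
    by (auto simp: maximal_fun_def less_SUP_iff indicator_def bergman_ball_def split: if_splits)
  also have "open \<dots>" by (intro open_UN ballI open_bergman_ball_section) auto
  finally show "{z \<in> space borel. t < maximal_fun \<gamma> f z * indicator unit_ball z} \<in> sets borel" by simp
qed

lemma norm_le_maximal_fun:
  assumes "\<gamma> > 0" "norm z < 1"
  shows "ennreal (cmod (f z)) \<le> maximal_fun \<gamma> f z"
  unfolding maximal_fun_def using assms
  by (intro SUP_upper) (simp add: bergman_ball_def bergman_metric_def ball_aut_self)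

theorem theorem1p1:
  fixes \<gamma> \<alpha> p :: real
  assumes "\<gamma> > 0" and "\<alpha> > -1" and "p > 0"
  shows "(\<forall>f \<in> holomorphic_functions (unit_ball :: (complex ^ 'n) set).
            f \<in> bergman_space p \<alpha> \<longleftrightarrow> maximal_fun \<gamma> f \<in> Lp_space_enn p (weighted_measure \<alpha>))
       \<and> (\<exists>C > 0. \<forall>f \<in> holomorphic_functions (unit_ball :: (complex ^ 'n) set).
            ennreal (inverse C) * Lp_norm p (weighted_measure \<alpha>) (maximal_fun \<gamma> f)
              \<le> Lp_norm p (weighted_measure \<alpha>) (\<lambda>z. ennreal (norm (f z)))
          \<and> Lp_norm p (weighted_measure \<alpha>) (\<lambda>z. ennreal (norm (f z)))
              \<le> ennreal C * Lp_norm p (weighted_measure \<alpha>) (maximal_fun \<gamma> f))"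
proof -
  let ?W = "weighted_measure \<alpha> :: (complex ^ 'n) measure"
  let ?n = "\<lambda>f z. ennreal (cmod (f z))"
  have p: "p > 0" and p1: "1 / p > 0" using assms by auto
  obtain C0 where C0: "C0 > 0"
    and max_le: "\<And>f. f \<in> holomorphic_functions (unit_ball :: (complex ^ 'n) set) \<Longrightarrow>
      (\<integral>\<^sup>+z. ennpowr (maximal_fun \<gamma> f z) p * ennreal (defect z powr \<alpha>) * indicator unit_ball z \<partial>lborel)
      \<le> ennreal C0 * (\<integral>\<^sup>+z. ennreal (cmod (f z) powr p) * ennreal (defect z powr \<alpha>) * indicator unit_ball z \<partial>lborel)"
    using maximal_integral_le[OF p] by blast
  obtain c where c: "c > 0" and int: "\<And>g :: complex ^ 'n \<Rightarrow> ennreal.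
    (\<lambda>z. g z * indicator unit_ball z) \<in> borel_measurable borel \<Longrightarrow>
    (\<integral>\<^sup>+z. g z \<partial>?W) = ennreal c * (\<integral>\<^sup>+z. g z * ennreal (defect z powr \<alpha>) * indicator unit_ball z \<partial>lborel)"
    using nn_integral_weighted_measure[OF assms(2)] by blast
  define C where "C = max 1 (C0 powr (1 / p))"
  have C: "C \<ge> 1" by (simp add: C_def)
  have upper: "Lp_norm p ?W (maximal_fun \<gamma> f) \<le> ennreal C * Lp_norm p ?W (?n f)"
    if f: "f \<in> holomorphic_functions unit_ball" for f
  proof -
    have [measurable]: "(\<lambda>z. maximal_fun \<gamma> f z * indicator unit_ball z) \<in> borel_measurable borel"
      by (rule borel_measurable_maximal_fun)
    have "(\<lambda>z. ennpowr (maximal_fun \<gamma> f z * indicator unit_ball z) p) \<in> borel_measurable borel"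
      by measurable
    also have "(\<lambda>z. ennpowr (maximal_fun \<gamma> f z * indicator unit_ball z) p)
        = (\<lambda>z. ennpowr (maximal_fun \<gamma> f z) p * indicator unit_ball z)"
      using p by (auto simp: indicator_def ennpowr_def)
    finally have "(\<integral>\<^sup>+z. ennpowr (maximal_fun \<gamma> f z) p \<partial>?W)
        = ennreal c * (\<integral>\<^sup>+z. ennpowr (maximal_fun \<gamma> f z) p * ennreal (defect z powr \<alpha>) * indicator unit_ball z \<partial>lborel)"
      by (rule int)
    also have "\<dots> \<le> ennreal c * (ennreal C0 * (\<integral>\<^sup>+z. ennreal (cmod (f z) powr p) * ennreal (defect z powr \<alpha>) * indicator unit_ball z \<partial>lborel))"
      by (intro mult_left_mono max_le f) simp
    also have "\<dots> = ennreal C0 * (\<integral>\<^sup>+z. ennreal (cmod (f z) powr p) \<partial>?W)"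
      by (subst int[OF borel_measurable_norm_powr[OF f p]]) (simp add: mult_ac)
    finally have "Lp_norm p ?W (maximal_fun \<gamma> f) \<le> ennpowr (ennreal C0 * (\<integral>\<^sup>+z. ennpowr (?n f z) p \<partial>?W)) (1 / p)"
      unfolding Lp_norm_def using p1 by (intro ennpowr_mono) (simp_all add: ennpowr_ennreal)
    also have "\<dots> = ennreal (C0 powr (1 / p)) * Lp_norm p ?W (?n f)"
      unfolding Lp_norm_def by (rule ennpowr_cmult[OF C0])
    also have "\<dots> \<le> ennreal C * Lp_norm p ?W (?n f)"
      by (intro mult_right_mono ennreal_leI) (auto simp: C_def)
    finally show ?thesis .
  qed
  have lower: "Lp_norm p ?W (?n f) \<le> Lp_norm p ?W (maximal_fun \<gamma> f)" for f :: "complex ^ 'n \<Rightarrow> complex"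
    unfolding Lp_norm_def using p p1 assms(1)
    by (intro ennpowr_mono nn_integral_mono norm_le_maximal_fun) (auto simp: space_weighted_measure)
  show ?thesis
  proof (intro conjI ballI exI)
    fix f :: "complex ^ 'n \<Rightarrow> complex" assume f: "f \<in> holomorphic_functions unit_ball"
    have "f \<in> borel_measurable ?W"
    proof -
      have "(\<lambda>z. indicator (ball 0 1) z *\<^sub>R f z) \<in> borel_measurable borel"
        by (intro borel_measurable_continuous_on_indicator holomorphic_functions_continuous_on f) simp
      then have "(\<lambda>z. indicator (ball 0 1) z *\<^sub>R f z) \<in> borel_measurable lebesgue"
        by (intro measurable_completion) simp
      then have "f \<in> borel_measurable (restrict_space lebesgue unit_ball)"
        by (subst borel_measurable_restrict_space_iff) auto
      then show ?thesis by (simp add: measurable_cong_sets[OF sets_weighted_measure refl])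
    qed
    moreover have "maximal_fun \<gamma> f \<in> borel_measurable ?W"
      by (intro borel_measurable_weighted_measure borel_measurable_maximal_fun)
    moreover have "Lp_norm p ?W (?n f) < \<infinity> \<longleftrightarrow> Lp_norm p ?W (maximal_fun \<gamma> f) < \<infinity>"
      using upper[OF f] lower[of f] by (auto simp: ennreal_mult_less_top intro: le_less_trans)
    ultimately show "f \<in> bergman_space p \<alpha> \<longleftrightarrow> maximal_fun \<gamma> f \<in> Lp_space_enn p ?W"
      using f by (simp add: bergman_space_def Lp_space_def Lp_space_enn_def)
  next
    show "C > 0" using C by simp
    fix f :: "complex ^ 'n \<Rightarrow> complex" assume f: "f \<in> holomorphic_functions unit_ball"
    have "ennreal (inverse C) * Lp_norm p ?W (maximal_fun \<gamma> f) \<le> ennreal (inverse C) * (ennreal C * Lp_norm p ?W (?n f))"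
      by (intro mult_left_mono upper f) simp
    also have "\<dots> = Lp_norm p ?W (?n f)"
      using C by (simp flip: mult.assoc ennreal_mult)
    finally show "ennreal (inverse C) * Lp_norm p ?W (maximal_fun \<gamma> f) \<le> Lp_norm p ?W (?n f)" .
    have "1 * Lp_norm p ?W (maximal_fun \<gamma> f) \<le> ennreal C * Lp_norm p ?W (maximal_fun \<gamma> f)"
      using C by (intro mult_right_mono) auto
    with lower[of f] show "Lp_norm p ?W (?n f) \<le> ennreal C * Lp_norm p ?W (maximal_fun \<gamma> f)"
      by simp
  qed
qed

end
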